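(* For a commutative nil-variety of semigroups $\mathcal V$, the following are equivalent: (a) $\mathcal V$ is an upper-modular element of the lattice $\mathbf{Com}$; (b) $\mathcal V$ is a codistributive element of the lattice $\mathbf{Com}$; (c) $\mathcal V$ is a costandard element of the lattice $\mathbf{Com}$; (d) $\mathcal V$ satisfies the identities $x^2yz=0$ and $x^2y=xy^2$.
   Context: A semigroup variety is a class of semigroups defined by a system of semigroup identities; it is commutative if it satisfies $xy=yx$, and a nil-variety if all its members are nilsemigroups (semigroups with zero in which every element has a power equal to $0$). $\mathbf{Com}$ is the lattice of all commutative semigroup varieties ordered by inclusion (meet $\wedge$ is intersection; join $\vee$ is the least variety containing both). For a word $w$, the notation $w=0$ is a short form of the identity system $wx=xw=w$ where $x$ is a letter not occurring in $w$ (equivalently, the semigroup has a zero element $0$ and all values of $w$ equal $0$). An element $x$ of a lattice $L$ is called: upper-modular if for all $y,z\in L$, $y\le x$ implies $x\wedge(y\vee z)=y\vee(x\wedge z)$; codistributive if $x\wedge(y\vee z)=(x\wedge y)\vee(x\wedge z)$ for all $y,z\in L$; costandard if $(x\wedge y)\vee z=(x\vee z)\wedge(y\vee z)$ for all $y,z\in L$. *)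

theory Defs
  imports "HOL-Algebra.Lattice" "HOL-Library.Countable_Set"
begin

section \<open>Semigroups\<close>

record 'a sgrp = "'a partial_object" +
  prd :: "['a, 'a] \<Rightarrow> 'a" (infixl \<open>\<cdot>\<index>\<close> 70)

definition semigroup_on :: "'a sgrp \<Rightarrow> bool" where
  "semigroup_on S \<longleftrightarrow>
     carrier S \<noteq> {} \<and>
     (\<forall>a\<in>carrier S. \<forall>b\<in>carrier S. a \<cdot>\<^bsub>S\<^esub> b \<in> carrier S) \<and>
     (\<forall>a\<in>carrier S. \<forall>b\<in>carrier S. \<forall>c\<in>carrier S.
        (a \<cdot>\<^bsub>S\<^esub> b) \<cdot>\<^bsub>S\<^esub> c = a \<cdot>\<^bsub>S\<^esub> (b \<cdot>\<^bsub>S\<^esub> c))"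

text \<open>The product of a nonempty list of elements; there is no product of the empty list.\<close>

fun sprod :: "'a sgrp \<Rightarrow> 'a list \<Rightarrow> 'a" where
  "sprod S [a] = a"
| "sprod S (a # b # as) = a \<cdot>\<^bsub>S\<^esub> sprod S (b # as)"

definition is_zero :: "'a sgrp \<Rightarrow> 'a \<Rightarrow> bool" where
  "is_zero S z \<longleftrightarrow> z \<in> carrier S \<and> (\<forall>a\<in>carrier S. z \<cdot>\<^bsub>S\<^esub> a = z \<and> a \<cdot>\<^bsub>S\<^esub> z = z)"

definition nilsemigroup :: "'a sgrp \<Rightarrow> bool" where
  "nilsemigroup S \<longleftrightarrow>
     semigroup_on S \<and>
     (\<exists>z. is_zero S z \<and> (\<forall>a\<in>carrier S. \<exists>n>0. sprod S (replicate n a) = z))"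


section \<open>Identities and varieties\<close>

text \<open>The letters are the natural numbers; a semigroup word is a nonempty list of letters.\<close>

type_synonym word = "nat list"
type_synonym identity = "word \<times> word"

definition is_identity :: "identity \<Rightarrow> bool" where
  "is_identity e \<longleftrightarrow> fst e \<noteq> [] \<and> snd e \<noteq> []"

definition satisfies :: "'a sgrp \<Rightarrow> identity \<Rightarrow> bool" where
  "satisfies S e \<longleftrightarrow>
     (\<forall>\<phi>. (\<forall>i. \<phi> i \<in> carrier S) \<longrightarrow> sprod S (map \<phi> (fst e)) = sprod S (map \<phi> (snd e)))"

definition models :: "identity set \<Rightarrow> 'a sgrp set" where
  "models \<Sigma> = {S. semigroup_on S \<and> (\<forall>e\<in>\<Sigma>. satisfies S e)}"

text \<open>
  Since HOL has no proper classes, a variety is represented by its members whose carrier is a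
  subset of the type \<^typ>\<open>'a\<close>.  Nothing is lost if \<^typ>\<open>'a\<close> is infinite: a variety
  is determined by its countable members, and these have isomorphic copies over \<^typ>\<open>'a\<close>
  (cf. \<open>models_subset_iff\<close> below).
\<close>

definition variety :: "'a sgrp set \<Rightarrow> bool" where
  "variety V \<longleftrightarrow> (\<exists>\<Sigma>. (\<forall>e\<in>\<Sigma>. is_identity e) \<and> V = models \<Sigma>)"

definition variety_satisfies :: "'a sgrp set \<Rightarrow> identity set \<Rightarrow> bool" where
  "variety_satisfies V \<Sigma> \<longleftrightarrow> (\<forall>S\<in>V. \<forall>e\<in>\<Sigma>. satisfies S e)"

text \<open>The system written \<open>w = 0\<close>, that is \<open>wx = xw = w\<close> with \<open>x\<close> not occurring in \<open>w\<close>.\<close>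

definition zero_identities :: "word \<Rightarrow> identity set" where
  "zero_identities w = (\<Union>x\<in>- set w. {(w @ [x], w), (x # w, w)})"

definition commutative_variety :: "'a sgrp set \<Rightarrow> bool" where
  "commutative_variety V \<longleftrightarrow> variety V \<and> variety_satisfies V {([0, 1], [1, 0])}"

definition nil_variety :: "'a sgrp set \<Rightarrow> bool" where
  "nil_variety V \<longleftrightarrow> variety V \<and> (\<forall>S\<in>V. nilsemigroup S)"

definition Com :: "'a sgrp set gorder" where
  "Com = \<lparr>carrier = {V. commutative_variety V}, eq = (=), le = (\<subseteq>)\<rparr>"


section \<open>Special elements of lattices\<close>

definition upper_modular_element :: "('b, 'c) gorder_scheme \<Rightarrow> 'b \<Rightarrow> bool" where
  "upper_modular_element L x \<longleftrightarrow> x \<in> carrier L \<and>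
     (\<forall>y\<in>carrier L. \<forall>z\<in>carrier L.
        y \<sqsubseteq>\<^bsub>L\<^esub> x \<longrightarrow> x \<sqinter>\<^bsub>L\<^esub> (y \<squnion>\<^bsub>L\<^esub> z) = y \<squnion>\<^bsub>L\<^esub> (x \<sqinter>\<^bsub>L\<^esub> z))"

definition codistributive_element :: "('b, 'c) gorder_scheme \<Rightarrow> 'b \<Rightarrow> bool" where
  "codistributive_element L x \<longleftrightarrow> x \<in> carrier L \<and>
     (\<forall>y\<in>carrier L. \<forall>z\<in>carrier L.
        x \<sqinter>\<^bsub>L\<^esub> (y \<squnion>\<^bsub>L\<^esub> z) = (x \<sqinter>\<^bsub>L\<^esub> y) \<squnion>\<^bsub>L\<^esub> (x \<sqinter>\<^bsub>L\<^esub> z))"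

definition costandard_element :: "('b, 'c) gorder_scheme \<Rightarrow> 'b \<Rightarrow> bool" where
  "costandard_element L x \<longleftrightarrow> x \<in> carrier L \<and>
     (\<forall>y\<in>carrier L. \<forall>z\<in>carrier L.
        (x \<sqinter>\<^bsub>L\<^esub> y) \<squnion>\<^bsub>L\<^esub> z = (x \<squnion>\<^bsub>L\<^esub> z) \<sqinter>\<^bsub>L\<^esub> (y \<squnion>\<^bsub>L\<^esub> z))"


section \<open>\<open>Com\<close> is a lattice\<close>

lemma variety_Int:
  assumes "variety V" "variety W"
  shows "variety (V \<inter> W)"
proof -
  obtain A where A: "\<forall>e\<in>A. is_identity e" "V = models A"
    using assms(1) by (auto simp: variety_def)
  obtain B where B: "\<forall>e\<in>B. is_identity e" "W = models B"
    using assms(2) by (auto simp: variety_def)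
  have "V \<inter> W = models (A \<union> B)"
    by (auto simp: A(2) B(2) models_def)
  moreover have "\<forall>e\<in>A \<union> B. is_identity e"
    using A(1) B(1) by auto
  ultimately show ?thesis
    unfolding variety_def by (intro exI[of _ "A \<union> B"]) simp
qed

text \<open>The least variety containing a given class of semigroups.\<close>

definition variety_generated :: "'a sgrp set \<Rightarrow> 'a sgrp set" where
  "variety_generated K = models {e. is_identity e \<and> variety_satisfies K {e}}"

lemma variety_variety_generated: "variety (variety_generated K)"
  unfolding variety_def variety_generated_def
  by (rule exI[of _ "{e. is_identity e \<and> variety_satisfies K {e}}"]) simp

lemma subset_variety_generated:
  assumes "\<And>S. S \<in> K \<Longrightarrow> semigroup_on S"
  shows "K \<subseteq> variety_generated K"
  using assms by (auto simp: variety_generated_def models_def variety_satisfies_def)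

lemma variety_generated_least:
  assumes "variety W" "K \<subseteq> W"
  shows "variety_generated K \<subseteq> W"
proof -
  obtain \<Sigma> where \<Sigma>: "\<forall>e\<in>\<Sigma>. is_identity e" "W = models \<Sigma>"
    using assms(1) by (auto simp: variety_def)
  have "\<Sigma> \<subseteq> {e. is_identity e \<and> variety_satisfies K {e}}"
    using \<Sigma> assms(2) by (auto simp: variety_satisfies_def models_def)
  then show ?thesis
    unfolding variety_generated_def \<Sigma>(2) models_def by auto
qed

lemma variety_semigroup: "variety V \<Longrightarrow> S \<in> V \<Longrightarrow> semigroup_on S"
  by (auto simp: variety_def models_def)

lemma commutative_variety_Int:
  "commutative_variety V \<Longrightarrow> commutative_variety W \<Longrightarrow> commutative_variety (V \<inter> W)"
  by (auto simp: commutative_variety_def variety_Int variety_satisfies_def)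

lemma commutative_variety_join:
  assumes "commutative_variety V" "commutative_variety W"
  shows "commutative_variety (variety_generated (V \<union> W))"
proof -
  have "variety_satisfies (V \<union> W) {([0, 1], [1, 0])}"
    using assms unfolding commutative_variety_def variety_satisfies_def by blast
  then have "([0, 1], [1, 0]) \<in> {e. is_identity e \<and> variety_satisfies (V \<union> W) {e}}"
    by (simp add: is_identity_def)
  then have "satisfies S ([0, 1], [1, 0])" if "S \<in> variety_generated (V \<union> W)" for S
    using that unfolding variety_generated_def models_def by (simp del: One_nat_def)
  then have "variety_satisfies (variety_generated (V \<union> W)) {([0, 1], [1, 0])}"
    by (simp add: variety_satisfies_def)
  then show ?thesis
    using variety_variety_generated unfolding commutative_variety_def by blast
qed

lemma Com_simps [simp]:
  "carrier Com = {V. commutative_variety V}"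
  "V \<sqsubseteq>\<^bsub>Com\<^esub> W \<longleftrightarrow> V \<subseteq> W"
  "V .=\<^bsub>Com\<^esub> W \<longleftrightarrow> V = W"
  by (simp_all add: Com_def)

lemma Com_is_glb:
  assumes "commutative_variety V" "commutative_variety W"
  shows "is_glb Com (V \<inter> W) {V, W}"
  using assms by (auto simp: greatest_def Lower_def commutative_variety_Int)

lemma Com_is_lub:
  assumes "commutative_variety V" "commutative_variety W"
  shows "is_lub Com (variety_generated (V \<union> W)) {V, W}"
proof -
  have "V \<union> W \<subseteq> variety_generated (V \<union> W)"
    using assms by (intro subset_variety_generated)
      (auto simp: commutative_variety_def dest: variety_semigroup)
  moreover have "variety_generated (V \<union> W) \<subseteq> U"
    if "commutative_variety U" "V \<subseteq> U" "W \<subseteq> U" for U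
    using that by (intro variety_generated_least) (auto simp: commutative_variety_def)
  ultimately show ?thesis
    using assms commutative_variety_join[OF assms] unfolding least_def Upper_def by simp
qed

lemma lattice_Com: "lattice Com"
proof unfold_locales
  show "(.=\<^bsub>Com\<^esub>) = (=)" by (simp add: fun_eq_iff)
next
  fix V W :: "'a sgrp set"
  assume "V \<in> carrier Com" "W \<in> carrier Com"
  then have VW: "commutative_variety V" "commutative_variety W" by simp_all
  show "\<exists>s. is_lub Com s {V, W}" by (rule exI, rule Com_is_lub[OF VW])
  show "\<exists>s. is_glb Com s {V, W}" by (rule exI, rule Com_is_glb[OF VW])
qed simp_all

lemma Com_meet:
  assumes "commutative_variety V" "commutative_variety W"
  shows "V \<sqinter>\<^bsub>Com\<^esub> W = V \<inter> W"
proof -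
  interpret lattice Com by (rule lattice_Com)
  show ?thesis
    using Com_is_glb[OF assms] greatest_unique unfolding meet_def inf_def
    by (metis (no_types, lifting) someI_ex)
qed

lemma Com_join:
  assumes "commutative_variety V" "commutative_variety W"
  shows "V \<squnion>\<^bsub>Com\<^esub> W = variety_generated (V \<union> W)"
proof -
  interpret lattice Com by (rule lattice_Com)
  show ?thesis
    using Com_is_lub[OF assms] least_unique unfolding join_def sup_def
    by (metis (no_types, lifting) someI_ex)
qed


section \<open>Independence of the universe\<close>

lemma sprod_closed:
  assumes "semigroup_on S" "as \<noteq> []" "set as \<subseteq> carrier S"
  shows "sprod S as \<in> carrier S"
  using assms by (induction S as rule: sprod.induct) (auto simp: semigroup_on_def)

lemma sprod_append:
  assumes "semigroup_on S" "set as \<subseteq> carrier S" "set bs \<subseteq> carrier S" "as \<noteq> []" "bs \<noteq> []"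
  shows "sprod S (as @ bs) = sprod S as \<cdot>\<^bsub>S\<^esub> sprod S bs"
  using assms
proof (induction S as rule: sprod.induct)
  case (1 S a)
  then show ?case by (cases bs) auto
next
  case (2 S a b as)
  have "sprod S (b # as) \<in> carrier S" "sprod S bs \<in> carrier S"
    using 2 by (simp_all add: sprod_closed)
  then show ?case
    using 2 by (auto simp: semigroup_on_def)
qed auto

lemma sprod_hom:
  assumes "semigroup_on S" "as \<noteq> []" "set as \<subseteq> carrier S"
    and "\<And>a b. a \<in> carrier S \<Longrightarrow> b \<in> carrier S \<Longrightarrow> f (a \<cdot>\<^bsub>S\<^esub> b) = f a \<cdot>\<^bsub>T\<^esub> f b"
  shows "f (sprod S as) = sprod T (map f as)"
  using assms by (induction S as rule: sprod.induct) (auto simp: sprod_closed)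

lemma satisfies_transfer:
  fixes S :: "'b sgrp" and T :: "'a sgrp"
  assumes S: "semigroup_on S" and sub: "B \<subseteq> carrier S"
    and cl: "\<And>a b. a \<in> B \<Longrightarrow> b \<in> B \<Longrightarrow> a \<cdot>\<^bsub>S\<^esub> b \<in> B"
    and inj: "inj_on h B" and e: "is_identity e"
    and T: "T = \<lparr>carrier = h ` B, prd = (\<lambda>x y. h (inv_into B h x \<cdot>\<^bsub>S\<^esub> inv_into B h y))\<rparr>"
    and B: "B \<noteq> {}"
  shows "semigroup_on T"
    and "satisfies T e \<longleftrightarrow>
           (\<forall>\<phi>. (\<forall>i. \<phi> i \<in> B) \<longrightarrow> sprod S (map \<phi> (fst e)) = sprod S (map \<phi> (snd e)))"
proof -
  define R where "R = \<lparr>carrier = B, prd = prd S\<rparr>"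
  have R: "semigroup_on R"
    using S sub cl B by (auto simp: R_def semigroup_on_def subset_iff)
  have hom: "h (a \<cdot>\<^bsub>R\<^esub> b) = h a \<cdot>\<^bsub>T\<^esub> h b" if "a \<in> carrier R" "b \<in> carrier R" for a b
    using that inj by (auto simp: R_def T inv_into_f_f)
  have RS: "sprod R as = sprod S as" if "as \<noteq> []" for as
    using that by (induction as rule: induct_list012) (auto simp: R_def)
  show "semigroup_on T"
    using S sub cl B inj unfolding semigroup_on_def T
    by (auto simp: inv_into_f_f subset_iff)
  have eq: "h (sprod S (map \<phi> w)) = sprod T (map (h \<circ> \<phi>) w)"
    if "w \<noteq> []" "\<forall>i. \<phi> i \<in> B" for w \<phi>
    using sprod_hom[OF R, of "map \<phi> w" h T] that hom RS[of "map \<phi> w"] by (auto simp: R_def)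
  have mem: "sprod S (map \<phi> w) \<in> B" if "w \<noteq> []" "\<forall>i. \<phi> i \<in> B" for w \<phi>
    using sprod_closed[OF R, of "map \<phi> w"] that RS[of "map \<phi> w"] by (auto simp: R_def)
  have ne: "fst e \<noteq> []" "snd e \<noteq> []"
    using e by (auto simp: is_identity_def)
  show "satisfies T e \<longleftrightarrow>
      (\<forall>\<phi>. (\<forall>i. \<phi> i \<in> B) \<longrightarrow> sprod S (map \<phi> (fst e)) = sprod S (map \<phi> (snd e)))" (is "_ \<longleftrightarrow> ?R")
  proof
    assume sat: "satisfies T e"
    show ?R
    proof (intro allI impI)
      fix \<phi> :: "nat \<Rightarrow> 'b" assume \<phi>: "\<forall>i. \<phi> i \<in> B"
      then have "\<forall>i. (h \<circ> \<phi>) i \<in> carrier T" by (simp add: T)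
      then have "sprod T (map (h \<circ> \<phi>) (fst e)) = sprod T (map (h \<circ> \<phi>) (snd e))"
        using sat unfolding satisfies_def by blast
      then have "h (sprod S (map \<phi> (fst e))) = h (sprod S (map \<phi> (snd e)))"
        using eq[OF ne(1) \<phi>] eq[OF ne(2) \<phi>] by simp
      then show "sprod S (map \<phi> (fst e)) = sprod S (map \<phi> (snd e))"
        using inj mem[OF ne(1) \<phi>] mem[OF ne(2) \<phi>] by (auto dest: inj_onD)
    qed
  next
    assume r: ?R
    show "satisfies T e"
      unfolding satisfies_def
    proof (intro allI impI)
      fix \<psi> :: "nat \<Rightarrow> 'a" assume \<psi>: "\<forall>i. \<psi> i \<in> carrier T"
      define \<phi> where "\<phi> = inv_into B h \<circ> \<psi>"
      have \<phi>: "\<forall>i. \<phi> i \<in> B"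
        using \<psi> by (auto simp: \<phi>_def T intro: inv_into_into)
      have "h \<circ> \<phi> = \<psi>"
        using \<psi> by (auto simp: \<phi>_def T fun_eq_iff f_inv_into_f)
      then show "sprod T (map \<psi> (fst e)) = sprod T (map \<psi> (snd e))"
        using r \<phi> eq[OF ne(1) \<phi>] eq[OF ne(2) \<phi>] by metis
    qed
  qed
qed

lemma models_subset_transfer:
  assumes inf: "infinite (UNIV :: 'a set)" and le: "(models A :: 'a sgrp set) \<subseteq> models B"
    and A: "\<forall>e\<in>A. is_identity e" and B: "\<forall>e\<in>B. is_identity e"
  shows "(models A :: 'b sgrp set) \<subseteq> models B"
proof
  fix S :: "'b sgrp" assume SA: "S \<in> models A"
  then have S: "semigroup_on S" by (simp add: models_def)
  have "satisfies S e" if e: "e \<in> B" for e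
    unfolding satisfies_def
  proof (intro allI impI)
    fix \<phi> :: "nat \<Rightarrow> 'b" assume \<phi>: "\<forall>i. \<phi> i \<in> carrier S"
    define C where "C = (\<lambda>w. sprod S (map \<phi> w)) ` (- {[]})"
    have "countable C" by (simp add: C_def)
    obtain g :: "nat \<Rightarrow> 'a" where g: "inj g"
      using infinite_countable_subset[OF inf] by blast
    define h where "h = g \<circ> to_nat_on C"
    have inj: "inj_on h C"
      unfolding h_def using inj_on_to_nat_on[OF \<open>countable C\<close>] g
      by (intro comp_inj_on) (auto intro: inj_on_subset)
    have sub: "C \<subseteq> carrier S"
      using \<phi> unfolding C_def by (auto intro!: sprod_closed[OF S])
    have cl: "a \<cdot>\<^bsub>S\<^esub> b \<in> C" if ab: "a \<in> C" "b \<in> C" for a b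
    proof -
      obtain u v where "u \<noteq> []" "v \<noteq> []" "a = sprod S (map \<phi> u)" "b = sprod S (map \<phi> v)"
        using ab by (auto simp: C_def)
      then have "a \<cdot>\<^bsub>S\<^esub> b = sprod S (map \<phi> (u @ v))" "u @ v \<noteq> []"
        using sprod_append[OF S, of "map \<phi> u" "map \<phi> v"] \<phi>
        by (simp_all add: image_subset_iff)
      then show ?thesis unfolding C_def by blast
    qed
    have gen: "\<phi> i \<in> C" for i
      unfolding C_def by (rule image_eqI[of _ _ "[i]"]) auto
    then have ne: "C \<noteq> {}" by blast
    define T where
      "T = \<lparr>carrier = h ` C, prd = (\<lambda>x y. h (inv_into C h x \<cdot>\<^bsub>S\<^esub> inv_into C h y))\<rparr>"
    note tr = satisfies_transfer[OF S sub cl inj _ T_def ne]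
    have "satisfies T d" if "d \<in> A" for d
    proof -
      have "satisfies S d" using SA that by (simp add: models_def)
      then have "\<forall>\<psi>. (\<forall>i. \<psi> i \<in> C) \<longrightarrow> sprod S (map \<psi> (fst d)) = sprod S (map \<psi> (snd d))"
        using sub by (simp add: satisfies_def subset_iff)
      then show ?thesis using tr(2)[of d] A that by simp
    qed
    moreover have "semigroup_on T"
      using tr(1) e B by blast
    ultimately have "T \<in> models B"
      using le by (auto simp: models_def)
    then have "satisfies T e" using e by (simp add: models_def)
    then show "sprod S (map \<phi> (fst e)) = sprod S (map \<phi> (snd e))"
      using tr(2)[of e] e B gen by blast
  qed
  then show "S \<in> models B" using S by (simp add: models_def)
qed

lemma models_subset_iff:
  assumes "infinite (UNIV :: 'a set)" "infinite (UNIV :: 'b set)"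
    and "\<forall>e\<in>A. is_identity e" "\<forall>e\<in>B. is_identity e"
  shows "(models A :: 'a sgrp set) \<subseteq> models B \<longleftrightarrow> (models A :: 'b sgrp set) \<subseteq> models B"
  using assms by (blast intro: models_subset_transfer[THEN subsetD])

end

theory Submission
  imports Defs "HOL-Library.Multiset"
begin

text \<open>
  Modulo commutativity a word is a nonempty multiset of letters, and a commutative variety is
  determined by its equational theory, a fully invariant congruence on such multisets
  (\<open>comm_equational_theory\<close>).  Under this correspondence the join of \<^const>\<open>Com\<close> becomes the
  intersection of theories (\<open>theory_of_join\<close>), and the meet becomes the transitive closure of their
  union (\<open>theory_of_Int\<close>); the latter is Birkhoff's completeness theorem and rests on a relatively
  free semigroup.  The implications from costandard to codistributive to upper-modular hold in every
  lattice, and in a nil-variety \<open>x\<^sup>2y = xy\<^sup>2\<close> forces \<open>x\<^sup>2yz = 0\<close>: the identity yields both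
  \<open>x\<^sup>2yz = xy\<^sup>2z\<close> and, with \<open>yz\<close> for \<open>y\<close>, \<open>x\<^sup>2yz = xy\<^sup>2z\<^sup>2\<close>, so that \<open>x\<^sup>2yz = x\<^sup>2yz \<cdot> z\<close>.

  The heart of the proof is a rigidity property (\<open>thin_shift\<close>) of the words that \<open>x\<^sup>2yz = 0\<close> does
  not annihilate, namely the linear words and the words of length at most three; they are called
  thin here.  Whatever nontrivial identity \<open>u = p\<close> a commutative variety satisfies for a thin word
  \<open>u\<close>, it then also satisfies \<open>u = u x\<^sup>c\<close> for some \<open>c > 0\<close>, where \<open>x\<close> is a letter of \<open>u\<close> that depends
  on \<open>u\<close> alone; the only exception is \<open>x\<^sup>2y = xy\<^sup>2\<close>.

  Suppose that \<open>V\<close> satisfies the two identities.  To see that \<open>V\<close> is costandard, let \<open>u = v\<close> hold in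
  \<open>Z\<close> and in \<open>V \<inter> Y\<close>.  Unless \<open>u = v\<close> is trivial or of the form \<open>x\<^sup>2y = xy\<^sup>2\<close>, and unless \<open>u\<close> is
  zero in \<open>V\<close>, rigidity gives \<open>u = u x\<^sup>c\<close> in \<open>Y\<close> and \<open>u = u x\<^sup>d\<close> in \<open>Z\<close>, hence \<open>u = u x\<^bsup>3cd\<^esup>\<close> in
  both, and the right-hand side is zero in \<open>V\<close>.  The same works for \<open>v\<close>, and the two words so reached
  are equal both in \<open>V\<close> and in \<open>Z\<close>.  So \<open>u = v\<close> follows from identities common to \<open>Y\<close> and \<open>Z\<close> and
  identities common to \<open>V\<close> and \<open>Z\<close> (\<open>collapsing_theory_distributes\<close>).

  Suppose conversely that a nil-variety \<open>V\<close> is upper-modular but violates \<open>x\<^sup>2y = xy\<^sup>2\<close>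
  (\<open>upper_modular_imp_balanced\<close>).  Let \<open>Y\<close> be a subvariety of \<open>V\<close> given by \<open>x\<^sup>2y = xy\<^sup>2\<close> and further
  identities that say nothing more about \<open>x\<^sup>2y\<close>, and let \<open>Z\<close> be the variety of abelian groups of
  exponent dividing two.  As \<open>V \<inter> Z\<close> is trivial, \<open>x\<^sup>2y = xy\<^sup>2\<close> holds in \<open>Y \<squnion> (V \<sqinter> Z)\<close>, hence in
  \<open>V \<sqinter> (Y \<squnion> Z)\<close>.  But rigidity together with nilpotency makes \<open>x\<^sup>2y\<close> an isolated word of \<open>V\<close>, while
  in \<open>Y\<close> it equals only \<open>xy\<^sup>2\<close>, from which \<open>Z\<close> separates it.
\<close>

section \<open>Fully invariant congruences on commutative words\<close>

definition subst :: "('a \<Rightarrow> 'b multiset) \<Rightarrow> 'a multiset \<Rightarrow> 'b multiset" where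
  "subst \<sigma> m = \<Sum>\<^sub># (image_mset \<sigma> m)"

lemma subst_simps [simp]:
  "subst \<sigma> {#} = {#}"
  "subst \<sigma> (add_mset x m) = \<sigma> x + subst \<sigma> m"
  "subst \<sigma> (m + n) = subst \<sigma> m + subst \<sigma> n"
  by (simp_all add: subst_def)

lemma subst_replicate [simp]: "subst \<sigma> (replicate_mset k x) = repeat_mset k (\<sigma> x)"
  by (induction k) simp_all

lemma replicate_mset_add: "replicate_mset (j + k) x = replicate_mset j x + replicate_mset k x"
  by (induction j) simp_all

lemma subst_ident:
  assumes "\<And>x. x \<in># m \<Longrightarrow> \<sigma> x = {#x#}"
  shows "subst \<sigma> m = m"
  using assms by (induction m) simp_all

lemma subst_identify: "subst (\<lambda>_. {#x#}) m = replicate_mset (size m) x"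
  by (induction m) simp_all

lemma size_subst_ge:
  assumes "\<And>x. \<sigma> x \<noteq> {#}"
  shows "size m \<le> size (subst \<sigma> m)"
proof (induction m)
  case (add x m)
  have "size (\<sigma> x) \<ge> 1"
    using assms[of x] by (cases "\<sigma> x") auto
  with add show ?case by simp
qed simp

lemma subst_nonempty:
  assumes "\<And>x. \<sigma> x \<noteq> {#}" "m \<noteq> {#}"
  shows "subst \<sigma> m \<noteq> {#}"
  using assms by (cases m) auto

definition swap :: "'a \<Rightarrow> 'a \<Rightarrow> 'a \<Rightarrow> 'a multiset" where
  "swap x y z = {#if z = x then y else if z = y then x else z#}"

text \<open>
  The empty multiset is outside the field of the congruence, since semigroup words are nonempty;
  accordingly substitutions must not erase letters.
\<close>
locale comm_equational_theory =
  fixes E :: "'a multiset \<Rightarrow> 'a multiset \<Rightarrow> bool"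
  assumes E_nonempty: "E m n \<Longrightarrow> m \<noteq> {#} \<and> n \<noteq> {#}"
    and E_refl: "m \<noteq> {#} \<Longrightarrow> E m m"
    and E_sym: "E m n \<Longrightarrow> E n m"
    and E_trans [trans]: "E m n \<Longrightarrow> E n k \<Longrightarrow> E m k"
    and E_add: "E m n \<Longrightarrow> E (m + k) (n + k)"
    and E_subst: "E m n \<Longrightarrow> (\<And>x. \<sigma> x \<noteq> {#}) \<Longrightarrow> E (subst \<sigma> m) (subst \<sigma> n)"
begin

lemma iterate:
  assumes "E u (u + s)"
  shows "E u (u + repeat_mset k s)"
proof (induction k)
  case 0
  show ?case using E_nonempty[OF assms] E_refl by simp
next
  case (Suc k)
  have "E (u + repeat_mset k s) (u + s + repeat_mset k s)"
    by (rule E_add[OF assms])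
  with Suc E_trans show ?case by (metis add.assoc repeat_mset_Suc)
qed

lemma iterate_letter:
  assumes "E u (u + replicate_mset c x)"
  shows "E u (u + replicate_mset (k * c) x)"
  using iterate[OF assms, of k] by (metis repeat_mset_replicate_mset repeat_mset_right)

lemma E_add2: "E m n \<Longrightarrow> E m' n' \<Longrightarrow> E (m + m') (n + n')"
  using E_add[of m n m'] E_add[of m' n' n] E_trans by (simp add: add.commute)

lemma swap_letters:
  assumes "E m n"
  shows "E (subst (swap x y) m) (subst (swap x y) n)"
  by (rule E_subst[OF assms]) (simp add: swap_def)

text \<open>
  Identifying all letters in \<open>u = us\<close> shows that the powers of \<open>a\<close> with exponent at least
  \<open>size u\<close> are periodic with period \<open>size s\<close>.  Since \<open>u\<close> equals \<open>u s\<^sup>n\<close>, which contains such a power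
  of \<open>a\<close>, the word \<open>u\<close> inherits that period.
\<close>
lemma absorb_letter:
  assumes E: "E u (u + s)" and a: "a \<in># s"
  shows "E u (u + replicate_mset (size s) a)"
proof -
  let ?n = "size u"
  have pow: "E (replicate_mset ?n a) (replicate_mset (?n + size s) a)"
    using E_subst[OF E, of "\<lambda>_. {#a#}"] by (simp add: subst_identify)
  define r where "r = u + repeat_mset ?n s - replicate_mset ?n a"
  have "1 \<le> count s a" using a by (simp add: Suc_leI)
  then have "?n * 1 \<le> ?n * count s a" by (rule mult_le_mono2)
  then have "?n \<le> count (u + repeat_mset ?n s) a"
    unfolding count_union count_repeat_mset by linarith
  then have "replicate_mset ?n a \<subseteq># u + repeat_mset ?n s"
    by (auto simp: subseteq_mset_def)
  then have r: "u + repeat_mset ?n s = replicate_mset ?n a + r"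
    by (simp add: r_def)
  have 1: "E u (replicate_mset ?n a + r)"
    using iterate[OF E, of ?n] r by simp
  have 2: "E (replicate_mset ?n a + r) (replicate_mset ?n a + r + replicate_mset (size s) a)"
    using E_add[OF pow, of r] by (simp add: replicate_mset_add ac_simps)
  have 3: "E (replicate_mset ?n a + r + replicate_mset (size s) a) (u + replicate_mset (size s) a)"
    by (rule E_add[OF E_sym[OF 1]])
  show ?thesis using E_trans[OF E_trans[OF 1 2] 3] .
qed

lemma power_shift:
  assumes E: "E (replicate_mset m x) p" and p: "p \<noteq> replicate_mset m x"
  shows "\<exists>c>0. E (replicate_mset m x) (replicate_mset m x + replicate_mset c x)"
proof -
  have 1: "E (replicate_mset m x) (replicate_mset (size p) x)"
    using E_subst[OF E, of "\<lambda>_. {#x#}"] by (simp add: subst_identify)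
  consider "size p > m" | "size p < m" | "size p = m" by linarith
  then show ?thesis
  proof cases
    case 1
    with \<open>E (replicate_mset m x) (replicate_mset (size p) x)\<close> show ?thesis
      by (intro exI[of _ "size p - m"]) (simp flip: replicate_mset_add)
  next
    case 2
    \<comment> \<open>A power that equals a lower one is brought back above its own exponent by multiplication.\<close>
    have "E (replicate_mset (size p) x + replicate_mset (m - size p) x)
            (replicate_mset m x + replicate_mset (m - size p) x)"
      by (rule E_add[OF E_sym[OF 1]])
    with 2 show ?thesis
      by (intro exI[of _ "m - size p"]) (simp flip: replicate_mset_add)
  next
    case 3
    \<comment> \<open>If the lengths agree, squaring a letter other than \<open>x\<close> lengthens only one side.\<close>
    obtain y where y: "y \<in># p" "y \<noteq> x"
      using p 3 by (metis set_mset_subset_singletonD singletonI subsetI)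
    define \<sigma> where "\<sigma> z = (if z = y then {#x, x#} else {#x#})" for z
    have \<sigma>: "subst \<sigma> q = replicate_mset (size q + count q y) x" for q
      by (induction q) (auto simp: \<sigma>_def)
    have "E (subst \<sigma> (replicate_mset m x)) (subst \<sigma> p)"
      by (rule E_subst[OF E]) (simp add: \<sigma>_def)
    then have "E (replicate_mset m x) (replicate_mset (m + count p y) x)"
      unfolding \<sigma> using y 3 by simp
    with y show ?thesis
      by (intro exI[of _ "count p y"]) (simp flip: replicate_mset_add)
  qed
qed

lemma multiple_shift:
  assumes E: "E u (u + s)" and s: "s \<noteq> {#}"
  shows "\<exists>x\<in>#u. \<exists>c>0. E u (u + replicate_mset c x)"
proof -
  obtain z where z: "z \<in># s" using s by auto
  then have c: "size s > 0" by (metis nonempty_has_size empty_iff set_mset_empty)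
  have 1: "E u (u + replicate_mset (size s) z)"
    by (rule absorb_letter[OF E z])
  show ?thesis
  proof (cases "z \<in># u")
    case True
    with 1 c show ?thesis by blast
  next
    case False
    obtain x where x: "x \<in># u" using E_nonempty[OF E] by auto
    let ?\<sigma> = "\<lambda>i. if i = z then {#x#} else {#i#}"
    have "subst ?\<sigma> u = u"
      using False by (intro subst_ident) auto
    moreover have "E (subst ?\<sigma> u) (subst ?\<sigma> (u + replicate_mset (size s) z))"
      by (rule E_subst[OF 1]) simp
    ultimately have "E u (u + replicate_mset (size s) x)" by simp
    with x c show ?thesis by blast
  qed
qed

text \<open>
  If \<open>p\<close> misses a letter \<open>a\<close> of \<open>u\<close>, replacing \<open>a\<close> by its square changes \<open>u\<close> but not \<open>p\<close>, and
  \<open>u\<close> swallows \<open>a\<close>; otherwise \<open>u\<close> divides \<open>p\<close>.  The absorbed letter can be chosen freely because a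
  linear word is invariant under permutations of its letters.
\<close>
lemma linear_shift:
  assumes lin: "\<And>i. count u i \<le> 1" and x: "x \<in># u"
    and E: "E u p" and p: "p \<noteq> u"
  shows "\<exists>c>0. E u (u + replicate_mset c x)"
proof -
  have count1: "count u i = 1" if "i \<in># u" for i
    using lin[of i] that by (metis Suc_leI count_greater_zero_iff One_nat_def le_antisym)
  have "\<exists>s. s \<noteq> {#} \<and> E u (u + s)"
  proof (cases "set_mset u \<subseteq> set_mset p")
    case True
    then have "u \<subseteq># p"
      using lin by (auto simp: subseteq_mset_def) (metis count1 count_greater_zero_iff le0 le_zero_eq
         not_less_eq_eq not_in_iff subsetD One_nat_def)
    then show ?thesis
      using E p by (intro exI[of _ "p - u"]) (auto simp: Diff_eq_empty_iff_mset)
  next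
    case False
    then obtain a where a: "a \<in># u" "a \<notin># p" by auto
    let ?\<sigma> = "\<lambda>i. if i = a then {#a, a#} else {#i#}"
    have p': "subst ?\<sigma> p = p" using a by (intro subst_ident) auto
    obtain v where v: "u = add_mset a v" using a by (metis insert_DiffM)
    have "a \<notin># v" using lin[of a] by (auto simp: v not_in_iff)
    then have "subst ?\<sigma> v = v" by (intro subst_ident) auto
    then have u': "subst ?\<sigma> u = u + {#a#}" by (simp add: v)
    have "E (subst ?\<sigma> u) (subst ?\<sigma> p)"
      by (rule E_subst[OF E]) simp
    then have "E (u + {#a#}) p" by (simp only: p' u')
    then have "E u (u + {#a#})" by (rule E_trans[OF E E_sym])
    then show ?thesis by (intro exI[of _ "{#a#}"]) simp
  qed
  then obtain s where "s \<noteq> {#}" "E u (u + s)" by blast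
  from multiple_shift[OF this(2,1)]
  obtain a c where a: "a \<in># u" and c: "c > 0" "E u (u + replicate_mset c a)"
    by blast
  have swap: "subst (swap a x) u = u"
  proof (cases "a = x")
    case True
    then show ?thesis by (intro subst_ident) (simp add: swap_def)
  next
    case False
    define v where "v = u - {#a, x#}"
    have "{#a, x#} \<subseteq># u"
      using a x False by (auto simp: subseteq_mset_def Suc_le_eq)
    then have u: "u = {#a, x#} + v" unfolding v_def by (metis subset_mset.add_diff_inverse)
    have "a \<notin># v" "x \<notin># v"
      using lin[of a] lin[of x] False by (auto simp: u not_in_iff)
    then have "subst (swap a x) v = v"
      by (intro subst_ident) (auto simp: swap_def)
    then show ?thesis by (simp add: u swap_def)
  qed
  have "E (subst (swap a x) u) (subst (swap a x) (u + replicate_mset c a))"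
    by (rule E_subst[OF c(2)]) (simp add: swap_def)
  then have "E u (u + replicate_mset c x)"
    by (simp add: swap) (simp add: swap_def)
  with c show ?thesis by blast
qed

text \<open>
  The case that matters is \<open>x\<^sup>2y = x\<^sup>2y \<cdot> y\<^sup>c\<close>.  There \<open>x\<^sup>2y\<^bsup>c+1\<^esup>\<close> also contains the renamed word
  \<open>y\<^sup>2x\<close>, which absorbs \<open>x\<^sup>c\<close>.
\<close>
lemma square_times_letter_shift_aux:
  assumes xy: "x \<noteq> y" and E: "E {#x, x, y#} ({#x, x, y#} + s)" and s: "s \<noteq> {#}"
  shows "\<exists>c>0. E {#x, x, y#} ({#x, x, y#} + replicate_mset c x)"
proof -
  obtain z c where z: "z = x \<or> z = y" and c: "c > 0"
    and E: "E {#x, x, y#} ({#x, x, y#} + replicate_mset c z)"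
    using multiple_shift[OF E s] by auto
  show ?thesis
  proof (cases "z = x")
    case True
    with E c show ?thesis by blast
  next
    case False
    with z have zy: "z = y" by simp
    obtain d where d: "c = Suc d" using c by (cases c) auto
    have 1: "E {#y, y, x#} ({#y, y, x#} + replicate_mset c x)"
      using swap_letters[OF E, of x y] xy by (simp add: swap_def zy add_mset_commute)
    have 2: "E ({#x, x, y#} + replicate_mset c y) ({#x, x, y#} + replicate_mset c y + replicate_mset c x)"
      using E_add[OF 1, of "{#x#} + replicate_mset d y"] by (simp add: d add_mset_commute ac_simps)
    have 3: "E ({#x, x, y#} + replicate_mset c y + replicate_mset c x) ({#x, x, y#} + replicate_mset c x)"
      using E_add[OF E_sym[OF E], of "replicate_mset c x"] by (simp add: zy)
    have "E {#x, x, y#} ({#x, x, y#} + replicate_mset c x)"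
      using E_trans[OF E_trans[OF E[unfolded zy] 2] 3] .
    with c show ?thesis by blast
  qed
qed

text \<open>
  It suffices to derive an identity \<open>x\<^sup>2y = x\<^sup>2y \<cdot> s\<close> with \<open>s\<close> nonempty, and \<open>p\<close> itself gives one
  if it is divisible by \<open>x\<^sup>2y\<close>.  A letter missing from
  \<open>p\<close>, or one occurring only in \<open>p\<close>, yields it by a substitution that changes one side only.
  There remain the words \<open>p = xy\<^sup>b\<close>, where the excluded word is the one with \<open>b = 2\<close>.
\<close>
lemma square_times_letter_shift:
  assumes xy: "x \<noteq> y" and E: "E {#x, x, y#} p"
    and p: "p \<noteq> {#x, x, y#}" "p \<noteq> {#x, y, y#}"
  shows "\<exists>c>0. E {#x, x, y#} ({#x, x, y#} + replicate_mset c x)"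
proof -
  let ?u = "{#x, x, y#}"
  note aux = square_times_letter_shift_aux[OF xy]
  have above: ?thesis if "?u \<subseteq># q" "E ?u q" "q \<noteq> ?u" for q
  proof -
    obtain s where s: "q = ?u + s" using \<open>?u \<subseteq># q\<close> by (metis subset_mset.le_iff_add)
    have "s \<noteq> {#}" using that(3) by (auto simp: s)
    then show ?thesis using aux that(2) unfolding s by blast
  qed
  have above': ?thesis if "count q x \<ge> 2" "count q y \<ge> 1" "E ?u q" "q \<noteq> ?u" for q
    using that xy by (intro above[of q]) (auto simp: subseteq_mset_def)
  consider "y \<notin># p" | "x \<notin># p" | "count p x \<ge> 2" "y \<in># p" | "count p x = 1" "y \<in># p"
  proof -
    have "count p x = 0 \<or> count p x = 1 \<or> count p x \<ge> 2" by linarith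
    then show ?thesis using that by (auto simp: count_eq_zero_iff)
  qed
  then show ?thesis
  proof cases
    case 1
    let ?\<sigma> = "\<lambda>i. if i = y then {#y, y#} else {#i#}"
    have "subst ?\<sigma> p = p" using 1 by (intro subst_ident) auto
    moreover have "E (subst ?\<sigma> ?u) (subst ?\<sigma> p)"
      by (rule E_subst[OF E]) simp
    ultimately have "E ?u (?u + {#y#})"
      using xy E_trans[OF E E_sym] by (simp add: add_mset_commute)
    then show ?thesis by (rule aux) simp
  next
    case 2
    let ?\<sigma> = "\<lambda>i. if i = x then {#x, x#} else {#i#}"
    have "subst ?\<sigma> p = p" using 2 by (intro subst_ident) auto
    moreover have "E (subst ?\<sigma> ?u) (subst ?\<sigma> p)"
      by (rule E_subst[OF E]) simp
    ultimately have "E ?u (?u + {#x, x#})"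
      using xy E_trans[OF E E_sym] by (simp add: add_mset_commute)
    then show ?thesis by (rule aux) simp
  next
    case 3
    then have "count p y \<ge> 1" by (simp add: Suc_leI)
    with 3 E p show ?thesis by (intro above') auto
  next
    case 4
    show ?thesis
    proof (cases "set_mset p \<subseteq> {x, y}")
      case True
      define b where "b = count p y"
      have p_eq: "p = {#x#} + replicate_mset b y"
      proof (rule multiset_eqI)
        fix i
        show "count p i = count ({#x#} + replicate_mset b y) i"
          using 4 True xy by (auto simp: b_def not_in_iff[symmetric])
      qed
      have "b \<noteq> 0" using 4 by (simp add: b_def)
      moreover have "b \<noteq> 2" using p(2) by (auto simp: p_eq numeral_2_eq_2)
      ultimately have "b = 1 \<or> b = (b - 3) + 3" by linarith
      then consider "b = 1" | e where "b = e + 3" by blast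
      then show ?thesis
      proof cases
        case 1
        then have 1: "E {#x, y#} ?u" using E_sym[OF E] by (simp add: p_eq add_mset_commute)
        then have "E ?u (?u + {#x#})"
          using E_add[OF 1, of "{#x#}"] by (simp add: add_mset_commute)
        then show ?thesis by (rule aux) simp
      next
        case (2 e)
        let ?s = "replicate_mset (e + 1) x + replicate_mset (e + 1) y"
        \<comment> \<open>Here \<open>p = y\<^sup>2x \<cdot> y\<^bsup>e+1\<^esup>\<close>, so the identity with its letters interchanged applies to \<open>p\<close> itself.\<close>
        have p1: "p = {#y, y, x#} + replicate_mset (e + 1) y"
          using xy by (intro multiset_eqI) (simp add: p_eq 2)
        have p2: "{#y#} + replicate_mset (e + 3) x + replicate_mset (e + 1) y = ?u + ?s"
          using xy by (intro multiset_eqI) simp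
        have "E {#y, y, x#} ({#y#} + replicate_mset (e + 3) x)"
          using swap_letters[OF E, of x y] xy by (simp add: swap_def p_eq 2 add_mset_commute)
        then have "E p (?u + ?s)"
          unfolding p1 p2[symmetric] by (rule E_add)
        with E have "E ?u (?u + ?s)" by (rule E_trans)
        then show ?thesis by (rule aux) simp
      qed
    next
      case False
      then obtain z where z: "z \<in># p" "z \<noteq> x" "z \<noteq> y" by auto
      \<comment> \<open>Replacing \<open>z\<close> by \<open>x\<close> alone would turn \<open>p = xyz\<close> into \<open>x\<^sup>2y\<close> and lose all information.\<close>
      let ?\<sigma> = "\<lambda>i. if i = z then {#x, x#} else {#i#}"
      have cx: "count (subst ?\<sigma> q) x = count q x + 2 * count q z" for q
        using z by (induction q) auto
      have cy: "count (subst ?\<sigma> q) y = count q y" for q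
        using z xy by (induction q) auto
      have "E (subst ?\<sigma> ?u) (subst ?\<sigma> p)"
        by (rule E_subst[OF E]) simp
      then have E': "E ?u (subst ?\<sigma> p)"
        using z by (simp add: add_mset_commute)
      have "count p z \<ge> 1" "count p y \<ge> 1"
        using z 4 by (simp_all add: Suc_leI)
      then have c: "count (subst ?\<sigma> p) x \<ge> 3" "count (subst ?\<sigma> p) y \<ge> 1"
        using 4 by (simp_all add: cx cy)
      moreover have "subst ?\<sigma> p \<noteq> ?u"
      proof
        assume "subst ?\<sigma> p = ?u"
        then show False using c xy by simp
      qed
      ultimately show ?thesis
        using E' by (intro above'[of "subst ?\<sigma> p"]) simp_all
    qed
  qed
qed

end

section \<open>Rigidity of thin words\<close>

text \<open>The words that are not divisible by a substitution instance of \<open>x\<^sup>2yz\<close>.\<close>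
definition thin :: "'a multiset \<Rightarrow> bool" where
  "thin u \<longleftrightarrow> size u \<le> 3 \<or> (\<forall>i. count u i \<le> 1)"

text \<open>The pairs excepted from the rigidity property, trivial identities included.\<close>
definition kin :: "'a multiset \<Rightarrow> 'a multiset \<Rightarrow> bool" where
  "kin u v \<longleftrightarrow> v = u \<or> (\<exists>x y. x \<noteq> y \<and> u = {#x, x, y#} \<and> v = {#x, y, y#})"

lemma thin_cases:
  assumes "thin u" "x \<in># u" "\<And>i. count u i \<le> count u x"
  obtains (linear) "\<And>i. count u i \<le> 1"
  | (power) m where "u = replicate_mset m x"
  | (mixed) y where "y \<noteq> x" "u = {#x, x, y#}"
proof (cases "\<forall>i. count u i \<le> 1")
  case True
  then show ?thesis using linear by blast
next
  case False
  then obtain i where "count u i > 1" by (auto simp: not_le)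
  then have "count u x \<ge> 2" using assms(3)[of i] by simp
  then have "{#x, x#} \<subseteq># u" by (auto simp: subseteq_mset_def)
  then obtain v where v: "u = {#x, x#} + v" by (metis subset_mset.le_iff_add)
  have "size u \<le> 3" using assms(1) False unfolding thin_def by blast
  then have "size v \<le> 1" by (simp add: v)
  then consider "v = {#}" | y where "v = {#y#}"
    by (metis One_nat_def le_Suc_eq le_zero_eq size_1_singleton_mset size_eq_0_iff_empty)
  then show ?thesis
  proof cases
    case 1
    then show ?thesis using power[of 2] by (simp add: v numeral_2_eq_2)
  next
    case (2 y)
    then show ?thesis
      using power[of 3] mixed[of y] by (cases "y = x") (simp_all add: v eval_nat_numeral)
  qed
qed

text \<open>
  The absorbed letter is determined by \<open>u\<close> and not by the identity.  This is what later allows two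
  varieties to agree on a common multiple of their exponents.
\<close>
lemma (in comm_equational_theory) thin_shift:
  assumes "thin u" "x \<in># u" "\<And>i. count u i \<le> count u x"
    and E: "E u p" and p: "\<not> kin u p"
  shows "\<exists>c>0. E u (u + replicate_mset c x)"
  using assms(1-3)
proof (cases rule: thin_cases)
  case linear
  then show ?thesis
    using linear_shift[OF _ assms(2) E] p by (auto simp: kin_def)
next
  case (power m)
  then show ?thesis using power_shift[of m x p] E p by (auto simp: kin_def)
next
  case (mixed y)
  then show ?thesis using square_times_letter_shift[of x y p] E p by (auto simp: kin_def)
qed

section \<open>Commutative varieties and their equational theories\<close>

lemma mult_commute:
  assumes "satisfies S ([0, 1], [1, 0])" "a \<in> carrier S" "b \<in> carrier S"
  shows "a \<cdot>\<^bsub>S\<^esub> b = b \<cdot>\<^bsub>S\<^esub> a"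
  using assms(1)[unfolded satisfies_def, rule_format, of "\<lambda>i. if i = 0 then a else b"] assms(2,3)
  by simp

lemma sprod_mset_cong:
  assumes S: "semigroup_on S" and comm: "satisfies S ([0, 1], [1, 0])"
  shows "set as \<subseteq> carrier S \<Longrightarrow> mset as = mset bs \<Longrightarrow> sprod S as = sprod S bs"
proof (induction as arbitrary: bs)
  case (Cons a as)
  have "a \<in> set bs" using Cons.prems(2) by (metis list.set_intros(1) set_mset_mset)
  then obtain xs ys where bs: "bs = xs @ a # ys" by (meson split_list)
  have as: "mset as = mset (xs @ ys)" using Cons.prems(2) by (simp add: bs)
  have IH: "sprod S as = sprod S (xs @ ys)" using Cons as by simp
  have sub: "set xs \<subseteq> carrier S" "set ys \<subseteq> carrier S" "a \<in> carrier S"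
    using Cons.prems(1) mset_eq_setD[OF as] by auto
  have cons: "sprod S (c # cs) = c \<cdot>\<^bsub>S\<^esub> sprod S cs" if "cs \<noteq> []" for c cs
    using that by (cases cs) auto
  show ?case
  proof (cases "xs = []")
    case True
    have "as = [] \<longleftrightarrow> ys = []" using as True by auto
    then show ?thesis using IH True by (cases "ys = []") (simp_all add: bs cons)
  next
    case False
    have ne: "as \<noteq> []" using as False by auto
    have "sprod S (a # as) = a \<cdot>\<^bsub>S\<^esub> sprod S (xs @ ys)" using cons[OF ne] IH by simp
    also have "\<dots> = sprod S (xs @ [a] @ ys)"
    proof (cases "ys = []")
      case True
      then show ?thesis using False sub S
        by (simp add: sprod_append mult_commute[OF comm] sprod_closed)
    next
      case ys: False
      define p where "p = sprod S xs"
      define q where "q = sprod S ys"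
      have p: "p \<in> carrier S" "q \<in> carrier S"
        using False ys sub S by (simp_all add: p_def q_def sprod_closed)
      have "sprod S (xs @ [a] @ ys) = p \<cdot>\<^bsub>S\<^esub> (a \<cdot>\<^bsub>S\<^esub> q)"
        using False ys sub S by (simp add: sprod_append cons p_def q_def)
      also have "\<dots> = a \<cdot>\<^bsub>S\<^esub> (p \<cdot>\<^bsub>S\<^esub> q)"
        using S p sub mult_commute[OF comm, of p a] unfolding semigroup_on_def by metis
      finally show ?thesis
        using False ys sub S by (simp add: sprod_append p_def q_def)
    qed
    finally show ?thesis by (simp add: bs)
  qed
qed simp

text \<open>
  The relation is meant for commutative varieties, where a single pair of orderings \<open>u\<close>, \<open>v\<close>
  decides all of them (\<open>theory_of_mset\<close>).
\<close>
definition theory_of :: "'a sgrp set \<Rightarrow> nat multiset \<Rightarrow> nat multiset \<Rightarrow> bool" where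
  "theory_of V m n \<longleftrightarrow> m \<noteq> {#} \<and> n \<noteq> {#} \<and>
     (\<forall>u v. mset u = m \<longrightarrow> mset v = n \<longrightarrow> variety_satisfies V {(u, v)})"

lemma theory_ofI:
  assumes V: "commutative_variety V" and uv: "variety_satisfies V {(u, v)}" "u \<noteq> []" "v \<noteq> []"
  shows "theory_of V (mset u) (mset v)"
proof -
  have "satisfies S (u', v')" if S: "S \<in> V" and "mset u' = mset u" "mset v' = mset v" for S u' v'
  proof -
    have "semigroup_on S" "satisfies S ([0, 1], [1, 0])"
      using V S by (auto simp: commutative_variety_def variety_satisfies_def dest: variety_semigroup)
    note perm = sprod_mset_cong[OF this]
    show ?thesis
      unfolding satisfies_def
    proof (intro allI impI)
      fix \<phi> :: "nat \<Rightarrow> 'a" assume \<phi>: "\<forall>i. \<phi> i \<in> carrier S"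
      have "sprod S (map \<phi> u') = sprod S (map \<phi> u)" "sprod S (map \<phi> v') = sprod S (map \<phi> v)"
        using \<phi> that by (auto intro!: perm)
      then show "sprod S (map \<phi> (fst (u', v'))) = sprod S (map \<phi> (snd (u', v')))"
        using uv(1) S \<phi> by (simp add: variety_satisfies_def satisfies_def)
    qed
  qed
  then show ?thesis
    using uv by (auto simp: theory_of_def variety_satisfies_def)
qed

lemma theory_of_antimono: "V \<subseteq> W \<Longrightarrow> theory_of W m n \<Longrightarrow> theory_of V m n"
  unfolding theory_of_def variety_satisfies_def by blast

lemma theory_of_mset:
  assumes "commutative_variety V"
  shows "theory_of V (mset u) (mset v) \<longleftrightarrow> u \<noteq> [] \<and> v \<noteq> [] \<and> variety_satisfies V {(u, v)}"
  using theory_ofI[OF assms] by (auto simp: theory_of_def)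

lemma theory_ofD:
  assumes "theory_of V (mset u) (mset v)" "S \<in> V" "\<And>i. \<phi> i \<in> carrier S"
  shows "sprod S (map \<phi> u) = sprod S (map \<phi> v)"
  using assms by (simp add: theory_of_def variety_satisfies_def satisfies_def)

lemma sprod_concat:
  assumes S: "semigroup_on S" and ls: "\<And>l. l \<in> set ls \<Longrightarrow> l \<noteq> [] \<and> set l \<subseteq> carrier S"
  shows "ls \<noteq> [] \<Longrightarrow> sprod S (concat ls) = sprod S (map (sprod S) ls)"
  using ls
proof (induction ls rule: induct_list012)
  case (3 l k ls)
  have "set (concat (k # ls)) \<subseteq> carrier S" "concat (k # ls) \<noteq> []"
    using 3(4) by auto
  then have "sprod S (concat (l # k # ls)) = sprod S l \<cdot>\<^bsub>S\<^esub> sprod S (concat (k # ls))"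
    using 3(4)[of l] sprod_append[OF S, of l "concat (k # ls)"] by simp
  also have "sprod S (concat (k # ls)) = sprod S (map (sprod S) (k # ls))"
    by (rule 3(2)) (use 3(4) in auto)
  finally show ?case by simp
qed simp_all

lemma comm_equational_theory_theory_of:
  fixes V :: "'a sgrp set"
  assumes V: "commutative_variety V"
  shows "comm_equational_theory (theory_of V)"
proof -
  have sg: "semigroup_on S" if "S \<in> V" for S
    using V that by (auto simp: commutative_variety_def dest: variety_semigroup)
  have word: "\<exists>u. mset u = m" for m :: "nat multiset" by (rule ex_mset)
  show ?thesis
  proof
    fix m n :: "nat multiset"
    assume "theory_of V m n"
    then show "m \<noteq> {#} \<and> n \<noteq> {#}" "theory_of V n m"
      by (auto simp: theory_of_def variety_satisfies_def satisfies_def)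
  next
    fix m :: "nat multiset" assume m: "m \<noteq> {#}"
    obtain u where u: "mset u = m" using word by blast
    have "variety_satisfies V {(u, u)}" by (simp add: variety_satisfies_def satisfies_def)
    then show "theory_of V m m" using theory_ofI[OF V] m u by (metis mset.simps(1))
  next
    fix m n k :: "nat multiset"
    assume mn: "theory_of V m n" and nk: "theory_of V n k"
    obtain u v w where uvw: "mset u = m" "mset v = n" "mset w = k" using word by metis
    show "theory_of V m k"
      using mn nk unfolding uvw[symmetric] theory_of_mset[OF V]
      by (simp add: variety_satisfies_def satisfies_def)
  next
    fix m n k :: "nat multiset"
    assume mn: "theory_of V m n"
    obtain u v w where uvw: "mset u = m" "mset v = n" "mset w = k" using word by metis
    show "theory_of V (m + k) (n + k)"
    proof (cases "w = []")
      case True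
      with mn uvw show ?thesis by auto
    next
      case False
      show ?thesis
        using mn False unfolding uvw[symmetric] mset_append[symmetric] theory_of_mset[OF V]
        by (auto simp: variety_satisfies_def satisfies_def sprod_append[OF sg] image_subset_iff)
    qed
  next
    fix m n :: "nat multiset" and \<sigma> :: "nat \<Rightarrow> nat multiset"
    assume mn: "theory_of V m n" and \<sigma>: "\<And>x. \<sigma> x \<noteq> {#}"
    obtain u v where uv: "mset u = m" "mset v = n" using word by metis
    have "\<forall>i. \<exists>w. mset w = \<sigma> i" using word by blast
    then obtain \<tau> where \<tau>: "\<And>i. mset (\<tau> i) = \<sigma> i" by metis
    have ne: "\<tau> i \<noteq> []" for i using \<sigma>[of i] \<tau>[of i] by auto
    have sub: "mset (concat (map \<tau> w)) = subst \<sigma> (mset w)" for w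
      by (induction w) (simp_all add: \<tau>)
    have "theory_of V (mset (concat (map \<tau> u))) (mset (concat (map \<tau> v)))"
      unfolding theory_of_mset[OF V]
    proof (intro conjI)
      have "u \<noteq> []" "v \<noteq> []" using mn uv by (auto simp: theory_of_def)
      then show "concat (map \<tau> u) \<noteq> []" "concat (map \<tau> v) \<noteq> []"
        using ne by (cases u; auto; fail) (cases v; use \<open>v \<noteq> []\<close> ne in auto)
      have "sprod S (map \<phi> (concat (map \<tau> u))) = sprod S (map \<phi> (concat (map \<tau> v)))"
        if S: "S \<in> V" and \<phi>: "\<forall>i. \<phi> i \<in> carrier S" for S \<phi>
      proof -
        have eval: "sprod S (map \<phi> (concat (map \<tau> w))) = sprod S (map (\<lambda>i. sprod S (map \<phi> (\<tau> i))) w)"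
          if "w \<noteq> []" for w
        proof -
          have "sprod S (concat (map (\<lambda>i. map \<phi> (\<tau> i)) w)) =
                sprod S (map (sprod S) (map (\<lambda>i. map \<phi> (\<tau> i)) w))"
            using that \<phi> ne by (intro sprod_concat[OF sg[OF S]]) auto
          then show ?thesis by (simp add: map_concat comp_def)
        qed
        have "sprod S (map \<phi> (\<tau> i)) \<in> carrier S" for i
          using sprod_closed[OF sg[OF S]] ne \<phi> by (simp add: image_subset_iff)
        then show ?thesis
          using theory_ofD[of V u v S "\<lambda>i. sprod S (map \<phi> (\<tau> i))"] mn uv S
            \<open>u \<noteq> []\<close> \<open>v \<noteq> []\<close> by (simp add: eval)
      qed
      then show "variety_satisfies V {(concat (map \<tau> u), concat (map \<tau> v))}"
        by (simp add: variety_satisfies_def satisfies_def)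
    qed
    then show "theory_of V (subst \<sigma> m) (subst \<sigma> n)"
      by (simp only: sub uv)
  qed
qed

definition variety_of :: "(nat multiset \<Rightarrow> nat multiset \<Rightarrow> bool) \<Rightarrow> 'a sgrp set" where
  "variety_of E = models {(u, v). E (mset u) (mset v)}"

context comm_equational_theory
begin

text \<open>
  The relatively free semigroup is built on representatives rather than on congruence classes, so
  that its carrier is visibly a set of commutative words, and thus countable.
\<close>
definition normal_form :: "'a multiset \<Rightarrow> 'a multiset" where
  "normal_form m = (SOME n. E m n)"

lemma E_normal_form: "m \<noteq> {#} \<Longrightarrow> E m (normal_form m)"
  unfolding normal_form_def by (rule someI) (rule E_refl)

lemma normal_form_eq_iff:
  assumes "m \<noteq> {#}" "n \<noteq> {#}"
  shows "normal_form m = normal_form n \<longleftrightarrow> E m n"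
proof
  assume "normal_form m = normal_form n"
  then show "E m n"
    using E_normal_form[OF assms(1)] E_sym[OF E_normal_form[OF assms(2)]] E_trans by simp
next
  assume "E m n"
  then have "E m = E n" using E_trans E_sym by (intro ext) blast
  then show "normal_form m = normal_form n" by (simp add: normal_form_def)
qed

lemma normal_form_nonempty: "m \<noteq> {#} \<Longrightarrow> normal_form m \<noteq> {#}"
  using E_normal_form E_nonempty by blast

definition rel_free :: "'a multiset sgrp" where
  "rel_free = \<lparr>carrier = normal_form ` (- {{#}}), prd = (\<lambda>m n. normal_form (m + n))\<rparr>"

lemma normal_form_add:
  assumes "m \<noteq> {#}" "n \<noteq> {#}"
  shows "normal_form (normal_form m + normal_form n) = normal_form (m + n)"
  using assms E_add2[OF E_normal_form E_normal_form] E_sym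
  by (simp add: normal_form_eq_iff normal_form_nonempty)

lemma semigroup_rel_free: "semigroup_on rel_free"
proof -
  have "normal_form (normal_form (normal_form a + normal_form b) + normal_form c) =
        normal_form (normal_form a + normal_form (normal_form b + normal_form c))"
    if "a \<noteq> {#}" "b \<noteq> {#}" "c \<noteq> {#}" for a b c
    using that by (simp add: normal_form_add add.assoc)
  moreover have "{#undefined#} \<in> - {{#}}" by simp
  then have "- {{#}} \<noteq> ({} :: 'a multiset set)" by (metis emptyE)
  ultimately show ?thesis
    by (auto simp: semigroup_on_def rel_free_def normal_form_nonempty)
qed

lemma sprod_rel_free:
  assumes "\<And>i. \<sigma> i \<noteq> {#}" "w \<noteq> []"
  shows "sprod rel_free (map (\<lambda>i. normal_form (\<sigma> i)) w) = normal_form (subst \<sigma> (mset w))"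
  using assms(2)
proof (induction w rule: induct_list012)
  case (3 i j w)
  have "subst \<sigma> (mset (j # w)) \<noteq> {#}" using assms(1)[of j] by simp
  then show ?case using 3(2) assms(1)[of i] by (simp add: normal_form_add rel_free_def)
qed simp_all

end

text \<open>Countability of the relatively free semigroup lets a copy of it live on any infinite type.\<close>
lemma rel_free_copy:
  fixes E :: "nat multiset \<Rightarrow> nat multiset \<Rightarrow> bool"
  assumes inf: "infinite (UNIV :: 'a set)" and "comm_equational_theory E"
  obtains (copy) T :: "'a sgrp" where "semigroup_on T"
    and "\<And>u v. u \<noteq> [] \<Longrightarrow> v \<noteq> [] \<Longrightarrow> satisfies T (u, v) \<longleftrightarrow> E (mset u) (mset v)"
proof -
  interpret comm_equational_theory E by fact
  let ?C = "carrier rel_free"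
  have C: "?C = normal_form ` (- {{#}})" by (simp add: rel_free_def)
  have sat: "satisfies rel_free (u, v) \<longleftrightarrow> E (mset u) (mset v)" if uv: "u \<noteq> []" "v \<noteq> []" for u v
  proof
    assume "satisfies rel_free (u, v)"
    then have "sprod rel_free (map (\<lambda>i. normal_form {#i#}) u) =
               sprod rel_free (map (\<lambda>i. normal_form {#i#}) v)"
      by (auto simp: satisfies_def C)
    then have "normal_form (mset u) = normal_form (mset v)"
      using uv by (simp add: sprod_rel_free subst_ident)
    then show "E (mset u) (mset v)" using uv by (simp add: normal_form_eq_iff)
  next
    assume E: "E (mset u) (mset v)"
    show "satisfies rel_free (u, v)"
      unfolding satisfies_def
    proof (intro allI impI)
      fix \<phi> :: "nat \<Rightarrow> nat multiset" assume "\<forall>i. \<phi> i \<in> ?C"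
      then have "\<forall>i. \<exists>m. m \<noteq> {#} \<and> \<phi> i = normal_form m" by (auto simp: C)
      then obtain \<sigma> where \<sigma>: "\<And>i. \<sigma> i \<noteq> {#}" "\<And>i. \<phi> i = normal_form (\<sigma> i)" by metis
      have \<phi>: "\<phi> = (\<lambda>i. normal_form (\<sigma> i))" using \<sigma>(2) by blast
      show "sprod rel_free (map \<phi> (fst (u, v))) = sprod rel_free (map \<phi> (snd (u, v)))"
        using uv E_subst[OF E \<sigma>(1)]
        by (simp add: \<phi> sprod_rel_free[OF \<sigma>(1)] normal_form_eq_iff subst_nonempty[OF \<sigma>(1)])
    qed
  qed
  have "countable (UNIV :: nat multiset set)"
    using countable_image[of "UNIV :: word set" mset] by (simp add: surj_mset)
  then have count: "countable ?C" by (rule countable_subset[rotated]) simp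
  obtain g :: "nat \<Rightarrow> 'a" where g: "inj g"
    using infinite_countable_subset[OF inf] by blast
  define h where "h = g \<circ> to_nat_on ?C"
  have inj: "inj_on h ?C"
    unfolding h_def using inj_on_to_nat_on[OF count] g
    by (intro comp_inj_on) (auto intro: inj_on_subset)
  define T where "T = \<lparr>carrier = h ` ?C,
    prd = (\<lambda>x y. h (inv_into ?C h x \<cdot>\<^bsub>rel_free\<^esub> inv_into ?C h y))\<rparr>"
  note tr = satisfies_transfer[OF semigroup_rel_free subset_refl _ inj _ T_def]
  have cl: "a \<cdot>\<^bsub>rel_free\<^esub> b \<in> ?C" if "a \<in> ?C" "b \<in> ?C" for a b
    using semigroup_rel_free that by (simp add: semigroup_on_def)
  have ne: "?C \<noteq> {}" using semigroup_rel_free by (simp add: semigroup_on_def)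
  show thesis
  proof (rule copy)
    show "semigroup_on T" using tr(1)[OF cl _ ne, of "([0], [0])"] by (simp add: is_identity_def)
    fix u v :: word assume uv: "u \<noteq> []" "v \<noteq> []"
    then have "satisfies T (u, v) \<longleftrightarrow> satisfies rel_free (u, v)"
      using tr(2)[OF cl _ ne, of "(u, v)"] unfolding satisfies_def by (simp add: is_identity_def)
    then show "satisfies T (u, v) \<longleftrightarrow> E (mset u) (mset v)" using sat[OF uv] by simp
  qed
qed

lemma commutative_variety_variety_of:
  assumes "comm_equational_theory E"
  shows "commutative_variety (variety_of E)"
proof -
  interpret comm_equational_theory E by fact
  have "variety (variety_of E)"
    unfolding variety_def variety_of_def
    by (rule exI[of _ "{(u, v). E (mset u) (mset v)}"]) (auto simp: is_identity_def dest: E_nonempty)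
  moreover have "variety_satisfies (variety_of E) {([0, 1], [1, 0])}"
    using E_refl[of "{#0, 1#}"] by (auto simp: variety_satisfies_def variety_of_def models_def add_mset_commute)
  ultimately show ?thesis by (simp add: commutative_variety_def)
qed

lemma theory_of_variety_of:
  assumes "infinite (UNIV :: 'a set)" and E: "comm_equational_theory E"
  shows "theory_of (variety_of E :: 'a sgrp set) = E"
proof (intro ext iffI)
  interpret comm_equational_theory E by fact
  fix m n :: "nat multiset"
  obtain u v where uv: "m = mset u" "n = mset v" by (metis ex_mset)
  {
    assume "E m n"
    then have "variety_satisfies (variety_of E :: 'a sgrp set) {(u, v)}"
      by (auto simp: variety_satisfies_def variety_of_def models_def uv)
    moreover have "u \<noteq> []" "v \<noteq> []" using E_nonempty[OF \<open>E m n\<close>] by (auto simp: uv)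
    ultimately show "theory_of (variety_of E :: 'a sgrp set) m n"
      unfolding uv by (intro theory_ofI commutative_variety_variety_of[OF E])
  next
    assume *: "theory_of (variety_of E :: 'a sgrp set) m n"
    obtain T :: "'a sgrp" where T: "semigroup_on T"
      "\<And>u v. u \<noteq> [] \<Longrightarrow> v \<noteq> [] \<Longrightarrow> satisfies T (u, v) \<longleftrightarrow> E (mset u) (mset v)"
      using rel_free_copy[OF assms] by blast
    have "satisfies T (u', v')" if "E (mset u') (mset v')" for u' v'
      using T(2)[of u' v'] E_nonempty[OF that] that by auto
    with T(1) have "T \<in> variety_of E"
      by (auto simp: variety_of_def models_def)
    then have "satisfies T (u, v)"
      using * by (simp add: uv theory_of_def variety_satisfies_def)
    moreover have "u \<noteq> []" "v \<noteq> []" using * by (auto simp: uv theory_of_def)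
    ultimately show "E m n" using T(2) by (simp add: uv)
  }
qed

lemma variety_of_theory_of:
  assumes V: "commutative_variety V"
  shows "variety_of (theory_of V) = V"
proof
  obtain \<Sigma> where \<Sigma>: "\<forall>e\<in>\<Sigma>. is_identity e" "V = models \<Sigma>"
    using V by (auto simp: commutative_variety_def variety_def)
  have "theory_of V (mset (fst e)) (mset (snd e))" if "e \<in> \<Sigma>" for e
    using that \<Sigma> by (intro theory_ofI[OF V])
      (auto simp: is_identity_def variety_satisfies_def models_def)
  then show "variety_of (theory_of V) \<subseteq> V"
    by (auto simp: variety_of_def models_def \<Sigma>(2))
  show "V \<subseteq> variety_of (theory_of V)"
    using V by (auto simp: variety_of_def models_def theory_of_mset[OF V] variety_satisfies_def
        commutative_variety_def dest: variety_semigroup)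
qed

lemma subset_iff_theory_of:
  assumes "commutative_variety V" "commutative_variety W"
  shows "V \<subseteq> W \<longleftrightarrow> (\<forall>m n. theory_of W m n \<longrightarrow> theory_of V m n)"
proof
  assume "V \<subseteq> W"
  then show "\<forall>m n. theory_of W m n \<longrightarrow> theory_of V m n"
    by (blast intro: theory_of_antimono)
next
  assume "\<forall>m n. theory_of W m n \<longrightarrow> theory_of V m n"
  then have "variety_of (theory_of V) \<subseteq> (variety_of (theory_of W) :: 'a sgrp set)"
    by (auto simp: variety_of_def models_def)
  then show "V \<subseteq> W" by (simp add: variety_of_theory_of assms)
qed

lemma theory_of_join:
  assumes "commutative_variety V" "commutative_variety W"
  shows "theory_of (V \<squnion>\<^bsub>Com\<^esub> W) m n \<longleftrightarrow> theory_of V m n \<and> theory_of W m n"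
proof -
  have J: "commutative_variety (variety_generated (V \<union> W))"
    by (rule commutative_variety_join[OF assms])
  obtain u v where uv: "m = mset u" "n = mset v" by (metis ex_mset)
  have sub: "V \<union> W \<subseteq> variety_generated (V \<union> W)"
    using assms by (intro subset_variety_generated)
      (auto simp: commutative_variety_def dest: variety_semigroup)
  have "variety_satisfies (variety_generated (V \<union> W)) {(u, v)} \<longleftrightarrow>
        variety_satisfies V {(u, v)} \<and> variety_satisfies W {(u, v)}"
    if "u \<noteq> []" "v \<noteq> []"
  proof
    assume "variety_satisfies (variety_generated (V \<union> W)) {(u, v)}"
    then show "variety_satisfies V {(u, v)} \<and> variety_satisfies W {(u, v)}"
      using sub by (auto simp: variety_satisfies_def)
  next
    assume "variety_satisfies V {(u, v)} \<and> variety_satisfies W {(u, v)}"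
    then have "(u, v) \<in> {e. is_identity e \<and> variety_satisfies (V \<union> W) {e}}"
      using that by (auto simp: is_identity_def variety_satisfies_def)
    then show "variety_satisfies (variety_generated (V \<union> W)) {(u, v)}"
      unfolding variety_generated_def by (auto simp: variety_satisfies_def models_def)
  qed
  then show ?thesis
    unfolding Com_join[OF assms] uv theory_of_mset[OF J] theory_of_mset[OF assms(1)]
      theory_of_mset[OF assms(2)] by auto
qed

definition theory_join ::
    "('a \<Rightarrow> 'a \<Rightarrow> bool) \<Rightarrow> ('a \<Rightarrow> 'a \<Rightarrow> bool) \<Rightarrow> 'a \<Rightarrow> 'a \<Rightarrow> bool" where
  "theory_join D E = (\<lambda>m n. D m n \<or> E m n)\<^sup>+\<^sup>+"

lemma theory_join_induct [consumes 1, case_names D E]: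
  assumes "theory_join D E m n" "P m"
    and "\<And>p q. P p \<Longrightarrow> D p q \<Longrightarrow> P q" "\<And>p q. P p \<Longrightarrow> E p q \<Longrightarrow> P q"
  shows "P n"
  using assms(1) unfolding theory_join_def
  by (induction rule: tranclp_induct) (use assms(2-) in blast)+

lemma theory_join_comm_equational_theory:
  assumes "comm_equational_theory D" "comm_equational_theory E"
  shows "comm_equational_theory (theory_join D E)"
proof -
  interpret D: comm_equational_theory D by fact
  interpret E: comm_equational_theory E by fact
  let ?R = "\<lambda>m n. D m n \<or> E m n"
  have mono: "?R\<^sup>+\<^sup>+ (f m) (f n)"
    if "?R\<^sup>+\<^sup>+ m n" "\<And>p q. ?R p q \<Longrightarrow> ?R (f p) (f q)" for f m n
    using that(1)
  proof (induction rule: tranclp_induct)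
    case (base n)
    then show ?case by (intro tranclp.r_into_trancl that(2))
  next
    case (step n k)
    show ?case using step.IH that(2)[OF step.hyps(2)] by (rule tranclp.trancl_into_trancl)
  qed
  show ?thesis
    unfolding theory_join_def
  proof
    fix m n assume mn: "?R\<^sup>+\<^sup>+ m n"
    then show "m \<noteq> {#} \<and> n \<noteq> {#}"
      by (induction rule: tranclp_induct) (auto dest: D.E_nonempty E.E_nonempty)
    show "?R\<^sup>+\<^sup>+ n m"
      using mn
    proof (induction rule: tranclp_induct)
      case (base y)
      then show ?case using D.E_sym E.E_sym by blast
    next
      case (step y z)
      then have "?R z y" using D.E_sym E.E_sym by blast
      with step.IH show ?case by (rule tranclp_into_tranclp2[rotated])
    qed
    show "?R\<^sup>+\<^sup>+ (m + k) (n + k)" for k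
      by (rule mono[OF mn]) (use D.E_add E.E_add in blast)
    show "?R\<^sup>+\<^sup>+ (subst \<sigma> m) (subst \<sigma> n)" if "\<And>x. \<sigma> x \<noteq> {#}" for \<sigma>
    proof (rule mono[OF mn])
      fix p q assume "?R p q"
      then show "?R (subst \<sigma> p) (subst \<sigma> q)"
        using D.E_subst[of p q \<sigma>] E.E_subst[of p q \<sigma>] that by blast
    qed
  next
    fix m :: "'a multiset" assume "m \<noteq> {#}"
    then show "?R\<^sup>+\<^sup>+ m m" using D.E_refl by blast
  qed (rule tranclp_trans)
qed

text \<open>
  The relatively free semigroup of the joined theory belongs to both varieties; this gives the
  inclusion from left to right.
\<close>
lemma theory_of_Int:
  fixes V W :: "'a sgrp set"
  assumes inf: "infinite (UNIV :: 'a set)"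
    and V: "commutative_variety V" and W: "commutative_variety W"
  shows "theory_of (V \<inter> W) = theory_join (theory_of V) (theory_of W)"
proof -
  let ?J = "theory_join (theory_of V) (theory_of W)"
  have J: "comm_equational_theory ?J"
    using V W by (intro theory_join_comm_equational_theory comm_equational_theory_theory_of)
  have VW: "commutative_variety (V \<inter> W)" by (rule commutative_variety_Int[OF V W])
  interpret VW: comm_equational_theory "theory_of (V \<inter> W)"
    by (rule comm_equational_theory_theory_of[OF VW])
  have "?J m n" if "theory_of (V \<inter> W) m n" for m n
  proof -
    have "variety_of ?J \<subseteq> (variety_of (theory_of V) :: 'a sgrp set)"
      "variety_of ?J \<subseteq> (variety_of (theory_of W) :: 'a sgrp set)"
      unfolding theory_join_def variety_of_def models_def by blast+
    then have "variety_of ?J \<subseteq> V \<inter> W"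
      unfolding variety_of_theory_of[OF V] variety_of_theory_of[OF W] by (rule Int_greatest)
    then have "theory_of (variety_of ?J :: 'a sgrp set) m n"
      using that by (rule theory_of_antimono)
    then show ?thesis by (simp add: theory_of_variety_of[OF inf J])
  qed
  moreover have "theory_of (V \<inter> W) m n" if "?J m n" for m n
  proof -
    have step: "theory_of (V \<inter> W) p q" if "theory_of V p q \<or> theory_of W p q" for p q
      using that theory_of_antimono[of "V \<inter> W"] by blast
    show ?thesis
      using that unfolding theory_join_def
      by (induction rule: tranclp_induct) (blast intro: step VW.E_trans)+
  qed
  ultimately show ?thesis by blast
qed

section \<open>Special elements of an arbitrary lattice\<close>
lemma (in lattice) costandard_imp_codistributive:
  assumes "costandard_element L x"
  shows "codistributive_element L x"
  unfolding codistributive_element_def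
proof (intro conjI ballI)
  show x: "x \<in> carrier L" using assms by (simp add: costandard_element_def)
  have cost: "(x \<sqinter> y) \<squnion> z = (x \<squnion> z) \<sqinter> (y \<squnion> z)" if "y \<in> carrier L" "z \<in> carrier L" for y z
    using assms that by (simp add: costandard_element_def)
  fix y z assume yz: "y \<in> carrier L" "z \<in> carrier L"
  note closed = x yz meet_closed join_closed
  have absorb: "x \<squnion> (x \<sqinter> z) = x" "x \<sqinter> (x \<squnion> y) = x"
    using closed by (auto intro!: le_antisym join_le join_left meet_left meet_le)
  have "(x \<sqinter> y) \<squnion> (x \<sqinter> z) = (x \<squnion> (x \<sqinter> z)) \<sqinter> (y \<squnion> (x \<sqinter> z))"
    using closed by (simp add: cost)
  also have "\<dots> = x \<sqinter> ((x \<sqinter> z) \<squnion> y)"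
    using closed by (simp add: absorb join_comm)
  also have "(x \<sqinter> z) \<squnion> y = (x \<squnion> y) \<sqinter> (z \<squnion> y)"
    using closed by (simp add: cost)
  also have "x \<sqinter> ((x \<squnion> y) \<sqinter> (z \<squnion> y)) = x \<sqinter> (x \<squnion> y) \<sqinter> (z \<squnion> y)"
    using closed by (simp add: weak_meet_assoc[unfolded eq_is_equal])
  also have "\<dots> = x \<sqinter> (y \<squnion> z)"
    using closed by (simp add: absorb join_comm)
  finally show "x \<sqinter> (y \<squnion> z) = (x \<sqinter> y) \<squnion> (x \<sqinter> z)" by simp
qed

lemma (in lattice) codistributive_imp_upper_modular:
  assumes "codistributive_element L x"
  shows "upper_modular_element L x"
proof -
  have x: "x \<in> carrier L" using assms by (simp add: codistributive_element_def)
  have "x \<sqinter> y = y" if "y \<in> carrier L" "y \<sqsubseteq> x" for y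
    using x that by (auto intro!: le_antisym meet_le meet_right)
  then show ?thesis
    using assms by (simp add: codistributive_element_def upper_modular_element_def)
qed

section \<open>Nil-varieties\<close>
lemma sprod_zero_factor:
  assumes S: "semigroup_on S" and z: "is_zero S z"
    and sub: "set as \<subseteq> carrier S" "set bs \<subseteq> carrier S" "set cs \<subseteq> carrier S"
    and bs: "bs \<noteq> []" "sprod S bs = z"
  shows "sprod S (as @ bs @ cs) = z"
proof -
  have 1: "sprod S (bs @ cs) = z"
    using sprod_append[OF S sub(2,3) bs(1)] sprod_closed[OF S _ sub(3)] z bs
    by (cases "cs = []") (auto simp: is_zero_def)
  show ?thesis
    using sprod_append[OF S sub(1), of "bs @ cs"] sprod_closed[OF S _ sub(1)] z bs sub 1
    by (cases "as = []") (auto simp: is_zero_def)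
qed

text \<open>
  The exponent that annihilates the value of \<open>x\<close> may vary with \<open>S\<close> and \<open>\<phi>\<close>; this is why the
  argument evaluates words instead of manipulating identities.
\<close>
lemma nil_value_zero:
  assumes V: "commutative_variety V" and nil: "nil_variety V"
    and E: "theory_of V (mset w) (mset w + replicate_mset c x)" and c: "c > 0"
    and S: "S \<in> V" and z: "is_zero S z" and \<phi>: "\<And>i. \<phi> i \<in> carrier S"
  shows "sprod S (map \<phi> w) = z"
proof -
  interpret comm_equational_theory "theory_of V"
    by (rule comm_equational_theory_theory_of[OF V])
  have sg: "semigroup_on S" using nil S by (auto simp: nil_variety_def nilsemigroup_def)
  obtain z' k where z': "is_zero S z'" and k: "k > 0" "sprod S (replicate k (\<phi> x)) = z'"
    using nil S \<phi>[of x] unfolding nil_variety_def nilsemigroup_def by metis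
  have "z' = z" using z z' unfolding is_zero_def by metis
  define d where "d = k * c - k"
  have d: "k * c = k + d" using c by (cases c) (simp_all add: d_def)
  have "theory_of V (mset w) (mset (w @ replicate k x @ replicate d x))"
    using iterate_letter[OF E, of k] by (simp add: d replicate_mset_add)
  then have "sprod S (map \<phi> w) = sprod S (map \<phi> (w @ replicate k x @ replicate d x))"
    using S \<phi> by (rule theory_ofD)
  also have "\<dots> = sprod S (map \<phi> w @ replicate k (\<phi> x) @ replicate d (\<phi> x))"
    by simp
  also have "\<dots> = z"
    using \<phi> k \<open>z' = z\<close> by (intro sprod_zero_factor[OF sg z]) auto
  finally show ?thesis .
qed

lemma nil_shift_collapse:
  assumes V: "commutative_variety V" and nil: "nil_variety V"
    and u: "theory_of V u (u + replicate_mset c x)" "c > 0"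
    and v: "theory_of V v (v + replicate_mset d y)" "d > 0"
  shows "theory_of V u v"
proof -
  obtain u' v' where uv: "u = mset u'" "v = mset v'" by (metis ex_mset)
  have "sprod S (map \<phi> u') = sprod S (map \<phi> v')"
    if "S \<in> V" "\<forall>i. \<phi> i \<in> carrier S" for S \<phi>
  proof -
    obtain z where "is_zero S z"
      using nil \<open>S \<in> V\<close> by (auto simp: nil_variety_def nilsemigroup_def)
    with that u v show ?thesis
      using nil_value_zero[OF V nil, of u' c x S z \<phi>] nil_value_zero[OF V nil, of v' d y S z \<phi>]
      by (simp add: uv)
  qed
  moreover have "u' \<noteq> []" "v' \<noteq> []" using u v by (auto simp: uv theory_of_def)
  ultimately show ?thesis
    unfolding uv by (intro theory_ofI[OF V]) (auto simp: variety_satisfies_def satisfies_def)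
qed

section \<open>The identities imply costandardness\<close>
lemma square_letter_eq_iff:
  assumes "x \<noteq> y" "{#x, y, y#} = {#a, a, b#}"
  shows "a = y \<and> b = x"
proof -
  have "count {#x, y, y#} y = count {#a, a, b#} y" using assms(2) by (rule arg_cong)
  then have "a = y" using assms(1) by (auto split: if_splits)
  with assms(2) show ?thesis by (simp add: add_mset_commute)
qed

lemma kin_square_letter_iff:
  assumes "x \<noteq> y"
  shows "kin {#x, x, y#} p \<longleftrightarrow> p = {#x, x, y#} \<or> p = {#x, y, y#}"
proof
  assume "kin {#x, x, y#} p"
  then consider "p = {#x, x, y#}"
    | a b where "a \<noteq> b" "{#x, x, y#} = {#a, a, b#}" "p = {#a, b, b#}"
    unfolding kin_def by blast
  then show "p = {#x, x, y#} \<or> p = {#x, y, y#}"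
  proof cases
    case (2 a b)
    have "{#y, x, x#} = {#a, a, b#}" using 2(2) by (simp add: add_mset_commute)
    then have "a = x \<and> b = y" using assms square_letter_eq_iff[of y x a b] by simp
    then show ?thesis using 2(3) by simp
  qed simp
next
  assume "p = {#x, x, y#} \<or> p = {#x, y, y#}"
  then show "kin {#x, x, y#} p" using assms unfolding kin_def by blast
qed

lemma kin_sym:
  assumes "kin u v"
  shows "kin v u"
proof (cases "v = u")
  case False
  then obtain x y where "x \<noteq> y" "u = {#x, x, y#}" "v = {#x, y, y#}"
    using assms unfolding kin_def by blast
  then have "y \<noteq> x" "v = {#y, y, x#}" "u = {#y, x, x#}"
    by (simp_all add: add_mset_commute)
  then show ?thesis unfolding kin_def by blast
qed (simp add: kin_def)

lemma kin_trans:
  assumes uv: "kin u v" and vw: "kin v w"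
  shows "kin u w"
proof (cases "v = u")
  case False
  then obtain x y where xy: "x \<noteq> y" "u = {#x, x, y#}" "v = {#x, y, y#}"
    using uv unfolding kin_def by blast
  have v: "v = {#y, y, x#}" and u: "u = {#y, x, x#}"
    using xy by (simp_all add: add_mset_commute)
  have "w = v \<or> w = u"
    using vw kin_square_letter_iff[of y x w] xy(1) unfolding v u by simp
  then show ?thesis using uv by (auto simp: kin_def)
qed (use vw in simp)

text \<open>The factor 3 guarantees length at least four.\<close>
lemma shift_not_thin:
  assumes "x \<in># u" "c > 0"
  shows "\<not> thin (u + replicate_mset (3 * c) x)"
proof -
  have "count u x \<ge> 1" using assms(1) by (simp add: Suc_leI)
  moreover have "count u x \<le> size u" by (rule count_le_size)
  ultimately have "size u + 3 * c > 3" "count u x + 3 * c > 1"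
    using assms(2) by linarith+
  then have "size (u + replicate_mset (3 * c) x) > 3" "count (u + replicate_mset (3 * c) x) x > 1"
    by simp_all
  then show ?thesis unfolding thin_def by (meson not_le)
qed

lemma ex_dominant_letter:
  assumes "u \<noteq> {#}"
  obtains x where "x \<in># u" "\<And>i. count u i \<le> count u x"
proof -
  have "finite (count u ` set_mset u)" "count u ` set_mset u \<noteq> {}" using assms by auto
  from Max_in[OF this] obtain x where x: "x \<in># u" "count u x = Max (count u ` set_mset u)"
    by auto
  have "count u i \<le> count u x" for i
    by (cases "i \<in># u") (auto simp: x not_in_iff)
  with x show ?thesis using that by blast
qed

text \<open>
  A derivation from \<open>u\<close> that leaves the words \<open>u\<close> and, if \<open>u = x\<^sup>2y\<close>, \<open>xy\<^sup>2\<close> must do so at some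
  step.  That step is not taken in \<open>N\<close>, since rigidity would make \<open>u\<close> equal there to a word that is
  not thin, contrary to the assumption; so it is taken in \<open>Y\<close>, where rigidity then applies.
\<close>
lemma leaving_kin_gives_shift:
  assumes N: "comm_equational_theory N" and Y: "comm_equational_theory Y"
    and sq: "\<And>x y. x \<noteq> y \<Longrightarrow> N {#x, x, y#} {#x, y, y#}"
    and thin: "thin u" "\<And>f. N u f \<Longrightarrow> thin f"
    and x: "x \<in># u" "\<And>i. count u i \<le> count u x"
    and uv: "theory_join N Y u v" "\<not> kin u v"
  shows "\<exists>c>0. Y u (u + replicate_mset c x)"
proof (rule ccontr)
  assume contra: "\<not> ?thesis"
  interpret N: comm_equational_theory N by fact
  interpret Y: comm_equational_theory Y by fact
  have "kin u v"
    using uv(1)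
  proof (induction rule: theory_join_induct)
    show "kin u u" by (simp add: kin_def)
  next
    fix p q assume p: "kin u p" and "N p q"
    have "u \<noteq> {#}" using x by auto
    then have "N u p" using p sq by (auto simp: kin_def intro: N.E_refl)
    then have uq: "N u q" using \<open>N p q\<close> by (rule N.E_trans)
    show "kin u q"
    proof (rule ccontr)
      assume "\<not> kin u q"
      then obtain c where c: "c > 0" "N u (u + replicate_mset c x)"
        using N.thin_shift[OF thin(1) x uq] by blast
      then show False
        using N.iterate_letter[of u c x 3] shift_not_thin[OF x(1) c(1)] thin(2) by blast
    qed
  next
    fix p q assume p: "kin u p" and "Y p q"
    show "kin u q"
    proof (rule ccontr)
      assume q: "\<not> kin u q"
      show False
      proof (cases "p = u")
        case True
        then show False using Y.thin_shift[OF thin(1) x _ q] \<open>Y p q\<close> contra by blast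
      next
        case False
        then obtain a b where ab: "a \<noteq> b" "u = {#a, a, b#}" "p = {#a, b, b#}"
          using p by (auto simp: kin_def)
        have "x = a"
        proof (rule ccontr)
          assume "x \<noteq> a"
          then show False using x(2)[of a] ab by (simp split: if_splits)
        qed
        have "\<not> kin p q" using p q kin_trans by blast
        moreover have "thin p" "b \<in># p" "\<And>i. count p i \<le> count p b"
          using ab by (auto simp: thin_def)
        ultimately obtain c where c: "c > 0" "Y p (p + replicate_mset c b)"
          using Y.thin_shift \<open>Y p q\<close> by blast
        have "Y u (u + replicate_mset c a)"
          using Y.swap_letters[OF c(2), of a b] ab by (simp add: swap_def add_mset_commute)
        then show False using contra c(1) \<open>x = a\<close> by blast
      qed
    qed
  qed
  with uv(2) show False by contradiction
qed

text \<open>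
  For the theories of three varieties this is the nontrivial inclusion in the definition of a
  costandard element, \<open>N\<close> being the theory of the element in question.
\<close>
lemma collapsing_theory_distributes:
  assumes N: "comm_equational_theory N" and Y: "comm_equational_theory Y"
    and Z: "comm_equational_theory Z"
    and sq: "\<And>x y. x \<noteq> y \<Longrightarrow> N {#x, x, y#} {#x, y, y#}"
    and thick: "\<And>m n. \<not> thin m \<Longrightarrow> \<not> thin n \<Longrightarrow> N m n"
    and uv: "theory_join N Y u v" "Z u v"
  shows "theory_join (\<lambda>m n. N m n \<and> Z m n) (\<lambda>m n. Y m n \<and> Z m n) u v"
proof -
  interpret N: comm_equational_theory N by fact
  interpret Y: comm_equational_theory Y by fact
  interpret Z: comm_equational_theory Z by fact
  let ?R = "\<lambda>m n. (N m n \<and> Z m n) \<or> (Y m n \<and> Z m n)"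
  interpret J: comm_equational_theory "theory_join N Y"
    by (rule theory_join_comm_equational_theory[OF N Y])
  \<comment> \<open>Each side of an identity outside \<open>kin\<close> is moved, by allowed steps, to a word that collapses in \<open>N\<close>.\<close>
  have reach: "\<exists>m f. ?R\<^sup>+\<^sup>+ u m \<and> ?R\<^sup>+\<^sup>+ m u \<and> Z u m \<and> N m f \<and> \<not> thin f"
    if uv: "theory_join N Y u v" "Z u v" "\<not> kin u v" for u v
  proof (cases "\<exists>f. N u f \<and> \<not> thin f")
    case True
    moreover have "u \<noteq> {#}" using Z.E_nonempty[OF uv(2)] by blast
    then have "?R u u" "Z u u" by (simp_all add: N.E_refl Z.E_refl)
    ultimately show ?thesis by (blast intro: tranclp.r_into_trancl)
  next
    case False
    have u: "u \<noteq> {#}" using Z.E_nonempty[OF uv(2)] by blast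
    have thin: "thin u" using False N.E_refl[OF u] by blast
    obtain x where x: "x \<in># u" "\<And>i. count u i \<le> count u x"
      using ex_dominant_letter[OF u] by blast
    obtain c where c: "c > 0" "Y u (u + replicate_mset c x)"
      using leaving_kin_gives_shift[OF N Y sq thin _ x uv(1,3)] False by blast
    obtain d where d: "d > 0" "Z u (u + replicate_mset d x)"
      using Z.thin_shift[OF thin x uv(2,3)] by blast
    let ?m = "u + replicate_mset (3 * (c * d)) x"
    have "Y u ?m" using Y.iterate_letter[OF c(2), of "3 * d"] by (simp add: ac_simps)
    moreover have "Z u ?m" using Z.iterate_letter[OF d(2), of "3 * c"] by (simp add: ac_simps)
    ultimately have "?R u ?m" "?R ?m u" "Z u ?m" by (auto intro: Y.E_sym Z.E_sym)
    moreover have "\<not> thin ?m" using shift_not_thin[OF x(1), of "c * d"] c d by simp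
    then have "N ?m ?m \<and> \<not> thin ?m" by (simp add: thick)
    ultimately show ?thesis by (blast intro: tranclp.r_into_trancl)
  qed
  have "?R\<^sup>+\<^sup>+ u v"
  proof (cases "kin u v")
    case True
    moreover have "u \<noteq> {#}" using Z.E_nonempty[OF uv(2)] by blast
    ultimately have "N u v" using sq by (auto simp: kin_def intro: N.E_refl)
    with uv(2) show ?thesis by blast
  next
    case False
    obtain m f where m: "?R\<^sup>+\<^sup>+ u m" "Z u m" "N m f" "\<not> thin f"
      using reach[OF uv False] by blast
    have "\<not> kin v u" using False kin_sym by blast
    then obtain n g where n: "?R\<^sup>+\<^sup>+ n v" "Z v n" "N n g" "\<not> thin g"
      using reach[OF J.E_sym[OF uv(1)] Z.E_sym[OF uv(2)]] by blast
    have "N m n"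
      using m(3) thick[OF m(4) n(4)] N.E_sym[OF n(3)] by (blast intro: N.E_trans)
    moreover have "Z m n"
      using Z.E_sym[OF m(2)] uv(2) n(2) by (blast intro: Z.E_trans)
    ultimately have "?R m n" by blast
    with m(1) have "?R\<^sup>+\<^sup>+ u n" by (rule tranclp.trancl_into_trancl)
    then show ?thesis using n(1) by (rule tranclp_trans)
  qed
  then show ?thesis by (simp add: theory_join_def)
qed

section \<open>Two auxiliary theories\<close>

text \<open>
  A theory that contains \<open>x\<^sup>2y = xy\<^sup>2\<close> and relates \<open>x\<^sup>2y\<close> to no further word.  In length three the
  content has to be preserved, because otherwise a substitution could lengthen only one side.
\<close>
definition short_theory :: "'a multiset \<Rightarrow> 'a multiset \<Rightarrow> bool" where
  "short_theory m n \<longleftrightarrow> m \<noteq> {#} \<and> n \<noteq> {#} \<and>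
     (m = n \<or> (size m = 3 \<and> size n = 3 \<and> set_mset m = set_mset n) \<or> (size m \<ge> 4 \<and> size n \<ge> 4))"

lemma set_mset_subst: "set_mset (subst \<sigma> m) = (\<Union>x\<in>set_mset m. set_mset (\<sigma> x))"
  by (induction m) auto

lemma size_subst_singletons:
  assumes "\<And>x. x \<in># m \<Longrightarrow> size (\<sigma> x) = 1"
  shows "size (subst \<sigma> m) = size m"
  using assms by (induction m) auto

lemma size_subst_gt:
  assumes "\<And>x. \<sigma> x \<noteq> {#}" "x \<in># m" "size (\<sigma> x) \<noteq> 1"
  shows "size (subst \<sigma> m) > size m"
proof -
  obtain m' where m: "m = add_mset x m'" using assms(2) by (metis insert_DiffM)
  have "size (\<sigma> x) \<noteq> 0" using assms(1)[of x] by simp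
  then have "size (\<sigma> x) \<ge> 2" using assms(3) by linarith
  then show ?thesis using size_subst_ge[of \<sigma> m'] assms(1) by (simp add: m)
qed

lemma comm_equational_theory_short: "comm_equational_theory short_theory"
proof
  fix m n k :: "'a multiset" assume mn: "short_theory m n"
  show "short_theory (m + k) (n + k)"
  proof (cases "k = {#}")
    case False
    then have "size k > 0" by (simp add: nonempty_has_size)
    with mn show ?thesis by (auto simp: short_theory_def)
  qed (use mn in simp)
next
  fix m n :: "'a multiset" and \<sigma> :: "'a \<Rightarrow> 'a multiset"
  assume mn: "short_theory m n" and \<sigma>: "\<And>x. \<sigma> x \<noteq> {#}"
  have ne: "subst \<sigma> m \<noteq> {#}" "subst \<sigma> n \<noteq> {#}"
    using mn by (auto simp: short_theory_def intro!: subst_nonempty[OF \<sigma>])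
  consider "m = n" | "size m = 3" "size n = 3" "set_mset m = set_mset n" | "size m \<ge> 4" "size n \<ge> 4"
    using mn by (auto simp: short_theory_def)
  then show "short_theory (subst \<sigma> m) (subst \<sigma> n)"
  proof cases
    case 1
    with ne show ?thesis by (simp add: short_theory_def)
  next
    case 2
    show ?thesis
    proof (cases "\<forall>x\<in>#m. size (\<sigma> x) = 1")
      case True
      then show ?thesis
        using 2 ne size_subst_singletons[of m \<sigma>] size_subst_singletons[of n \<sigma>]
        by (simp add: short_theory_def set_mset_subst)
    next
      case False
      then obtain x where "x \<in># m" "x \<in># n" "size (\<sigma> x) \<noteq> 1" using 2 by auto
      then show ?thesis
        using 2 ne size_subst_gt[of \<sigma> x m, OF \<sigma>] size_subst_gt[of \<sigma> x n, OF \<sigma>]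
        by (simp add: short_theory_def)
    qed
  next
    case 3
    then show ?thesis
      using ne size_subst_ge[of \<sigma> m, OF \<sigma>] size_subst_ge[of \<sigma> n, OF \<sigma>]
      by (simp add: short_theory_def)
  qed
next
  fix m n k :: "'a multiset"
  assume mn: "short_theory m n"
  then show "m \<noteq> {#} \<and> n \<noteq> {#}" by (simp add: short_theory_def)
  show "short_theory n m"
    using mn unfolding short_theory_def by (elim conjE disjE) simp_all
  assume "short_theory n k"
  with mn show "short_theory m k"
    unfolding short_theory_def by (elim conjE disjE) simp_all
qed (simp add: short_theory_def)

lemma short_theory_kin:
  assumes "x \<noteq> y" "short_theory {#x, x, y#} p"
  shows "kin {#x, x, y#} p"
proof (cases "p = {#x, x, y#}")
  case False
  then have p: "size p = 3" "set_mset p = {x, y}" using assms(2) by (auto simp: short_theory_def)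
  have "x \<in># p" "y \<in># p" using p by simp_all
  then obtain q where q: "p = {#x, y#} + q"
  proof -
    obtain r where r: "p = add_mset x r" using \<open>x \<in># p\<close> by (metis insert_DiffM)
    with \<open>y \<in># p\<close> assms(1) have "y \<in># r" by simp
    then obtain q where "r = add_mset y q" by (metis insert_DiffM)
    then show ?thesis using that by (simp add: r)
  qed
  then have "size q = 1" using p(1) by simp
  then obtain z where z: "q = {#z#}" by (metis size_1_singleton_mset)
  then have "z = x \<or> z = y" using p(2) by (auto simp: q)
  then show ?thesis using assms(1) False by (auto simp: kin_def q z add_mset_commute)
qed (simp add: kin_def)

text \<open>
  Equality of all letter multiplicities modulo two, that is, the theory of abelian groups of
  exponent dividing two.  Adding squares on both sides, rather than comparing parities, makes compatibility
  with substitutions immediate.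
\<close>
definition even_theory :: "'a multiset \<Rightarrow> 'a multiset \<Rightarrow> bool" where
  "even_theory m n \<longleftrightarrow> m \<noteq> {#} \<and> n \<noteq> {#} \<and> (\<exists>k l. m + (k + k) = n + (l + l))"

lemma comm_equational_theory_even: "comm_equational_theory even_theory"
proof
  fix m n k :: "'a multiset" assume mn: "even_theory m n"
  then show "m \<noteq> {#} \<and> n \<noteq> {#}" by (simp add: even_theory_def)
  show "even_theory n m"
    using mn unfolding even_theory_def by (blast intro: sym)
  obtain a b where ab: "m + (a + a) = n + (b + b)" using mn by (auto simp: even_theory_def)
  show "even_theory (m + k) (n + k)"
    using mn ab unfolding even_theory_def
    by (intro conjI exI[of _ a] exI[of _ b]) (auto simp: ac_simps)
  show "even_theory m k" if nk: "even_theory n k"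
  proof -
    obtain c d where cd: "n + (c + c) = k + (d + d)" using nk by (auto simp: even_theory_def)
    have "m + ((a + c) + (a + c)) = (m + (a + a)) + (c + c)" by (simp add: ac_simps)
    also have "\<dots> = (n + (c + c)) + (b + b)" unfolding ab by (simp add: ac_simps)
    also have "\<dots> = k + ((b + d) + (b + d))" unfolding cd by (simp add: ac_simps)
    finally show ?thesis using mn nk unfolding even_theory_def by blast
  qed
  show "even_theory (subst \<sigma> m) (subst \<sigma> n)" if \<sigma>: "\<And>x. \<sigma> x \<noteq> {#}" for \<sigma> :: "'a \<Rightarrow> 'a multiset"
  proof -
    have "subst \<sigma> (m + (a + a)) = subst \<sigma> (n + (b + b))" by (simp only: ab)
    then have "subst \<sigma> m + (subst \<sigma> a + subst \<sigma> a) = subst \<sigma> n + (subst \<sigma> b + subst \<sigma> b)"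
      by simp
    moreover have "subst \<sigma> m \<noteq> {#}" "subst \<sigma> n \<noteq> {#}"
      using mn subst_nonempty[of \<sigma> m, OF \<sigma>] subst_nonempty[of \<sigma> n, OF \<sigma>]
      by (simp_all add: even_theory_def)
    ultimately show ?thesis unfolding even_theory_def by blast
  qed
next
  fix m :: "'a multiset" assume "m \<noteq> {#}"
  then show "even_theory m m" by (auto simp: even_theory_def)
qed

section \<open>Upper-modularity implies the identities\<close>
lemma upper_modular_imp_balanced:
  fixes V :: "'a sgrp set"
  assumes inf: "infinite (UNIV :: 'a set)"
    and V: "commutative_variety V" and nil: "nil_variety V"
    and um: "upper_modular_element Com V"
  shows "theory_of V {#0, 0, 1#} {#0, 1, 1#}"
proof (rule ccontr)
  let ?N = "theory_of V"
  assume contra: "\<not> ?N {#0, 0, 1#} {#0, 1, 1#}"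
  interpret N: comm_equational_theory ?N
    by (rule comm_equational_theory_theory_of[OF V])
  have short: "comm_equational_theory (short_theory :: nat multiset \<Rightarrow> _)"
    by (rule comm_equational_theory_short)
  have even: "comm_equational_theory (even_theory :: nat multiset \<Rightarrow> _)"
    by (rule comm_equational_theory_even)
  define W :: "'a sgrp set" where "W = variety_of short_theory"
  define Y where "Y = V \<inter> W"
  define Z :: "'a sgrp set" where "Z = variety_of even_theory"
  have W: "commutative_variety W" "theory_of W = short_theory"
    unfolding W_def using commutative_variety_variety_of[OF short] theory_of_variety_of[OF inf short]
    by blast+
  have Z: "commutative_variety Z" "theory_of Z = even_theory"
    unfolding Z_def using commutative_variety_variety_of[OF even] theory_of_variety_of[OF inf even]
    by blast+
  have Y: "commutative_variety Y" "theory_of Y = theory_join ?N short_theory"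
    unfolding Y_def using commutative_variety_Int[OF V W(1)] theory_of_Int[OF inf V W(1)] W(2)
    by simp_all
  have VZ: "commutative_variety (V \<inter> Z)" by (rule commutative_variety_Int[OF V Z(1)])
  have YZ: "commutative_variety (Y \<squnion>\<^bsub>Com\<^esub> Z)"
    using commutative_variety_join[OF Y(1) Z(1)] by (simp add: Com_join[OF Y(1) Z(1)])
  have "V \<sqinter>\<^bsub>Com\<^esub> (Y \<squnion>\<^bsub>Com\<^esub> Z) = Y \<squnion>\<^bsub>Com\<^esub> (V \<sqinter>\<^bsub>Com\<^esub> Z)"
    using um Y(1) Z(1) by (simp add: upper_modular_element_def Y_def)
  then have eq: "V \<inter> (Y \<squnion>\<^bsub>Com\<^esub> Z) = Y \<squnion>\<^bsub>Com\<^esub> (V \<inter> Z)"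
    by (simp add: Com_meet[OF V YZ] Com_meet[OF V Z(1)])
  have "theory_of Y {#0, 0, 1#} {#0, 1, 1#}"
    unfolding Y(2) theory_join_def
    by (rule tranclp.r_into_trancl) (simp add: short_theory_def)
  moreover have "theory_of (V \<inter> Z) {#0, 0, 1#} {#0, 1, 1#}"
  proof -
    have nilVZ: "nil_variety (V \<inter> Z)"
      using nil VZ by (auto simp: nil_variety_def commutative_variety_def)
    \<comment> \<open>In \<open>V \<inter> Z\<close> every word absorbs squares, so by nilpotency all words are equal.\<close>
    have shift: "theory_of (V \<inter> Z) u (u + replicate_mset 2 x)" if "u \<noteq> {#}" for u x
    proof -
      have "even_theory u (u + replicate_mset 2 x)"
        using that unfolding even_theory_def
        by (intro conjI exI[of _ "{#x#}"] exI[of _ "{#}"]) (simp_all add: numeral_2_eq_2)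
      then show ?thesis
        unfolding theory_of_Int[OF inf V Z(1)] Z(2) theory_join_def by blast
    qed
    show ?thesis
      by (rule nil_shift_collapse[OF VZ nilVZ shift[of _ 0] _ shift[of _ 0]]) simp_all
  qed
  ultimately have "theory_of (V \<inter> (Y \<squnion>\<^bsub>Com\<^esub> Z)) {#0, 0, 1#} {#0, 1, 1#}"
    unfolding eq by (simp add: theory_of_join[OF Y(1) VZ])
  then have joined: "theory_join ?N (theory_of (Y \<squnion>\<^bsub>Com\<^esub> Z)) {#0, 0, 1#} {#0, 1, 1#}"
    unfolding theory_of_Int[OF inf V YZ] .
  \<comment> \<open>If \<open>x\<^sup>2y\<close> absorbed a letter in \<open>V\<close>, then \<open>xy\<^sup>2\<close> would do so too, and both would be zero.\<close>
  have no_shift: False if "?N {#x, x, y#} ({#x, x, y#} + replicate_mset c x)" "c > 0"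
    "x = 0 \<and> y = 1 \<or> x = 1 \<and> y = 0" for x y c
  proof -
    have xy: "x \<noteq> y" using that(3) by auto
    have "?N {#y, y, x#} ({#y, y, x#} + replicate_mset c y)"
      using N.swap_letters[OF that(1), of x y] xy by (simp add: swap_def add_mset_commute)
    then have "?N {#x, x, y#} {#y, y, x#}"
      by (rule nil_shift_collapse[OF V nil that(1,2) _ that(2)])
    then have "?N {#0, 0, 1#} {#0, 1, 1#}"
      using that(3) N.E_sym[of "{#x, x, y#}" "{#y, y, x#}"] by (auto simp: add_mset_commute)
    then show False using contra by contradiction
  qed
  have isolated: "p = {#x, x, y#}" if p: "?N {#x, x, y#} p" and xy: "x = 0 \<and> y = 1 \<or> x = 1 \<and> y = 0" for x y p
  proof -
    have ne: "x \<noteq> y" using xy by auto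
    have "kin {#x, x, y#} p"
    proof (rule ccontr)
      assume "\<not> kin {#x, x, y#} p"
      then have "\<exists>c>0. ?N {#x, x, y#} ({#x, x, y#} + replicate_mset c x)"
        using ne by (intro N.thin_shift[OF _ _ _ p]) (auto simp: thin_def)
      then show False using no_shift xy by blast
    qed
    moreover have "p \<noteq> {#x, y, y#}"
    proof
      assume "p = {#x, y, y#}"
      then have "?N {#0, 0, 1#} {#0, 1, 1#}"
        using p xy N.E_sym[of "{#x, x, y#}" p] by (auto simp: add_mset_commute)
      then show False using contra by contradiction
    qed
    ultimately show ?thesis
      using kin_square_letter_iff[OF ne, of p] by blast
  qed
  have "{#0, 1, 1#} = {#0, 0, 1 :: nat#}"
    using joined
  proof (induction rule: theory_join_induct)
    fix p q assume "p = {#0, 0, 1::nat#}" "?N p q"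
    then show "q = {#0, 0, 1#}" using isolated[of 0 1 q] by simp
  next
    fix p q assume p: "p = {#0, 0, 1::nat#}" and "theory_of (Y \<squnion>\<^bsub>Com\<^esub> Z) p q"
    then have q: "theory_join ?N short_theory {#0, 0, 1#} q" "even_theory {#0, 0, 1#} q"
      by (simp_all add: theory_of_join[OF Y(1) Z(1)] Y(2) Z(2))
    have flip: "{#0, 1, 1#} = {#1, 1, 0 :: nat#}" "{#1, 0, 0#} = {#0, 0, 1 :: nat#}"
      by (simp_all add: add_mset_commute)
    have "q = {#0, 0, 1#} \<or> q = {#1, 1, 0#}"
      using q(1)
    proof (induction rule: theory_join_induct)
      fix a b assume "a = {#0, 0, 1#} \<or> a = {#1, 1, 0#}" "?N a b"
      then show "b = {#0, 0, 1#} \<or> b = {#1, 1, 0#}"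
        using isolated[of 0 1 b] isolated[of 1 0 b] by auto
    next
      fix a b :: "nat multiset"
      assume "a = {#0, 0, 1#} \<or> a = {#1, 1, 0#}" "short_theory a b"
      then have "kin {#0, 0, 1#} b \<or> kin {#1, 1, 0#} b"
        using short_theory_kin[of 0 1 b] short_theory_kin[of 1 0 b] by auto
      then show "b = {#0, 0, 1#} \<or> b = {#1, 1, 0#}"
        using kin_square_letter_iff[of 0 1 b] kin_square_letter_iff[of 1 0 b] flip by auto
    qed blast
    moreover have "\<not> even_theory {#0, 0, 1#} {#1, 1, 0::nat#}"
    proof
      assume "even_theory {#0, 0, 1#} {#1, 1, 0::nat#}"
      then obtain k l where "{#0, 0, 1#} + (k + k) = {#1, 1, 0::nat#} + (l + l)"
        unfolding even_theory_def by blast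
      from arg_cong[OF this, of "\<lambda>m. count m 0"] show False by simp presburger
    qed
    ultimately show "q = {#0, 0, 1#}" using q(2) by blast
  qed simp
  then have "count {#0, 1, 1#} (0::nat) = count {#0, 0, 1#} (0::nat)" by (rule arg_cong)
  then show False by simp
qed

section \<open>The zero identity\<close>
lemma zero_identities_collapse:
  assumes V: "commutative_variety V"
    and zero: "variety_satisfies V (zero_identities [0, 0, 1, 2])"
    and m: "\<not> thin m" and n: "\<not> thin n"
  shows "theory_of V m n"
proof -
  interpret comm_equational_theory "theory_of V"
    by (rule comm_equational_theory_theory_of[OF V])
  have "([0, 0, 1, 2] @ [3], [0, 0, 1, 2]) \<in> zero_identities [0, 0, 1, 2]"
    unfolding zero_identities_def by (rule UN_I[of 3]) simp_all
  then have "variety_satisfies V {([0, 0, 1, 2] @ [3], [0, 0, 1, 2])}"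
    using zero unfolding variety_satisfies_def by blast
  from theory_ofI[OF V this]
  have E: "theory_of V {#0, 0, 1, 2, 3#} {#0, 0, 1, 2#}" by (simp add: add_mset_commute)
  have grow: "theory_of V (m + k) m" if m: "\<not> thin m" and k: "k \<noteq> {#}" for m k
  proof -
    obtain a where "count m a > 1" using m by (auto simp: thin_def not_le)
    then have "{#a, a#} \<subseteq># m" by (auto simp: subseteq_mset_def)
    then obtain r where r: "m = {#a, a#} + r" by (metis subset_mset.le_iff_add)
    have "size m > 3" using m by (auto simp: thin_def)
    then have "size r > 1" by (simp add: r)
    then obtain b s where s: "r = add_mset b s" "s \<noteq> {#}"
      by (metis One_nat_def less_irrefl less_nat_zero_code multiset_cases size_empty size_single)
    define \<sigma> where "\<sigma> i = (if i = 0 then {#a#} else if i = 1 then {#b#} else if i = 2 then s else k)"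
      for i :: nat
    have "theory_of V (subst \<sigma> {#0, 0, 1, 2, 3#}) (subst \<sigma> {#0, 0, 1, 2#})"
      using k s by (intro E_subst[OF E]) (simp add: \<sigma>_def)
    then show ?thesis by (simp add: \<sigma>_def r s)
  qed
  have "m \<noteq> {#}" "n \<noteq> {#}" using m n by (auto simp: thin_def)
  then have "theory_of V m (m + n)" "theory_of V (m + n) n"
    using grow[OF m, of n] grow[OF n, of m] E_sym by (simp_all add: add.commute)
  then show ?thesis by (rule E_trans)
qed

text \<open>Substituting \<open>yz\<close> for \<open>y\<close> in \<open>x\<^sup>2y = xy\<^sup>2\<close> gives \<open>x\<^sup>2yz = xy\<^sup>2z\<^sup>2\<close>; multiplying by \<open>z\<^sup>2\<close> gives
  \<open>x\<^sup>2yz\<^sup>2 = xy\<^sup>2z\<^sup>2\<close>.  So \<open>x\<^sup>2yz\<close> absorbs \<open>z\<close>.\<close>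
lemma balanced_imp_zero_identities:
  assumes V: "commutative_variety V" and nil: "nil_variety V"
    and E: "theory_of V {#0, 0, 1#} {#0, 1, 1#}"
  shows "variety_satisfies V (zero_identities [0, 0, 1, 2])"
proof -
  interpret comm_equational_theory "theory_of V"
    by (rule comm_equational_theory_theory_of[OF V])
  let ?u = "{#0, 0, 1, 2#} :: nat multiset"
  have "theory_of V {#0, 0, 1, 2, 2#} {#0, 1, 1, 2, 2#}"
    using E_add[OF E, of "{#2, 2#}"] by (simp add: add_mset_commute)
  moreover have "theory_of V ?u {#0, 1, 1, 2, 2#}"
    using E_subst[OF E, of "\<lambda>i. if i = 1 then {#1, 2#} else {#i#}"] by (simp add: add_mset_commute)
  ultimately have "theory_of V ?u {#0, 0, 1, 2, 2#}"
    using E_trans E_sym by blast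
  then have u: "theory_of V ?u (?u + replicate_mset 1 2)"
    by (simp add: add_mset_commute)
  have zero: "theory_of V (add_mset x ?u) ?u" for x
  proof -
    have "theory_of V (?u + {#x#}) (?u + {#x#} + replicate_mset 1 2)"
      using E_add[OF u, of "{#x#}"] by (simp add: ac_simps add_mset_commute)
    from nil_shift_collapse[OF V nil this _ u] show ?thesis by simp
  qed
  have "variety_satisfies V {([0, 0, 1, 2] @ [x], [0, 0, 1, 2])}"
    "variety_satisfies V {(x # [0, 0, 1, 2], [0, 0, 1, 2])}" for x
    using zero[of x] theory_of_mset[OF V, of "[0, 0, 1, 2] @ [x]" "[0, 0, 1, 2]"]
      theory_of_mset[OF V, of "x # [0, 0, 1, 2]" "[0, 0, 1, 2]"]
    by (simp_all add: add_mset_commute)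
  then show ?thesis
    unfolding variety_satisfies_def zero_identities_def by blast
qed

section \<open>The equivalence\<close>
lemma identities_imp_costandard:
  fixes V :: "'a sgrp set"
  assumes inf: "infinite (UNIV :: 'a set)" and V: "commutative_variety V"
    and zero: "variety_satisfies V (zero_identities [0, 0, 1, 2])"
    and sq: "theory_of V {#0, 0, 1#} {#0, 1, 1#}"
  shows "costandard_element Com V"
  unfolding costandard_element_def
proof (intro conjI ballI)
  show "V \<in> carrier Com" using V by simp
  fix Y Z :: "'a sgrp set"
  assume "Y \<in> carrier Com" "Z \<in> carrier Com"
  then have Y: "commutative_variety Y" and Z: "commutative_variety Z" by simp_all
  interpret N: comm_equational_theory "theory_of V"
    by (rule comm_equational_theory_theory_of[OF V])
  have join: "commutative_variety (A \<squnion>\<^bsub>Com\<^esub> B)"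
    if "commutative_variety A" "commutative_variety B" for A B :: "'a sgrp set"
    using commutative_variety_join[OF that] by (simp add: Com_join[OF that])
  note VY = commutative_variety_Int[OF V Y]
  note L = join[OF VY Z] and VZ = join[OF V Z] and YZ = join[OF Y Z]
  note R = commutative_variety_Int[OF VZ YZ]
  have sq': "theory_of V {#x, x, y#} {#x, y, y#}" if "x \<noteq> y" for x y
  proof -
    let ?\<sigma> = "\<lambda>i::nat. if i = 0 then {#x#} else {#y#}"
    have "theory_of V (subst ?\<sigma> {#0, 0, 1#}) (subst ?\<sigma> {#0, 1, 1#})"
      by (rule N.E_subst[OF sq]) simp
    then show ?thesis by (simp add: add_mset_commute)
  qed
  have "(V \<inter> Y) \<squnion>\<^bsub>Com\<^esub> Z = (V \<squnion>\<^bsub>Com\<^esub> Z) \<inter> (Y \<squnion>\<^bsub>Com\<^esub> Z)"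
  proof
    show "(V \<inter> Y) \<squnion>\<^bsub>Com\<^esub> Z \<subseteq> (V \<squnion>\<^bsub>Com\<^esub> Z) \<inter> (Y \<squnion>\<^bsub>Com\<^esub> Z)"
      using V Y Z VY VZ YZ L
      by (auto simp: subset_iff_theory_of theory_of_join theory_of_Int[OF inf] theory_join_def)
    show "(V \<squnion>\<^bsub>Com\<^esub> Z) \<inter> (Y \<squnion>\<^bsub>Com\<^esub> Z) \<subseteq> (V \<inter> Y) \<squnion>\<^bsub>Com\<^esub> Z"
      unfolding subset_iff_theory_of[OF R L]
    proof (intro allI impI)
      fix m n assume "theory_of ((V \<inter> Y) \<squnion>\<^bsub>Com\<^esub> Z) m n"
      then have mn: "theory_join (theory_of V) (theory_of Y) m n" "theory_of Z m n"
        by (simp_all add: theory_of_join[OF VY Z] theory_of_Int[OF inf V Y])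
      have "theory_join (\<lambda>m n. theory_of V m n \<and> theory_of Z m n)
              (\<lambda>m n. theory_of Y m n \<and> theory_of Z m n) m n"
        using V Y Z sq' zero_identities_collapse[OF V zero] mn
        by (intro collapsing_theory_distributes comm_equational_theory_theory_of)
      moreover have "theory_of (V \<squnion>\<^bsub>Com\<^esub> Z) = (\<lambda>m n. theory_of V m n \<and> theory_of Z m n)"
        "theory_of (Y \<squnion>\<^bsub>Com\<^esub> Z) = (\<lambda>m n. theory_of Y m n \<and> theory_of Z m n)"
        using theory_of_join[OF V Z] theory_of_join[OF Y Z] by (intro ext; simp)+
      ultimately show "theory_of ((V \<squnion>\<^bsub>Com\<^esub> Z) \<inter> (Y \<squnion>\<^bsub>Com\<^esub> Z)) m n"
        by (simp add: theory_of_Int[OF inf VZ YZ])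
    qed
  qed
  then show "(V \<sqinter>\<^bsub>Com\<^esub> Y) \<squnion>\<^bsub>Com\<^esub> Z = (V \<squnion>\<^bsub>Com\<^esub> Z) \<sqinter>\<^bsub>Com\<^esub> (Y \<squnion>\<^bsub>Com\<^esub> Z)"
    by (simp add: Com_meet[OF V Y] Com_meet[OF VZ YZ])
qed

theorem corollary4p2:
  fixes V :: "'a sgrp set"
  assumes "infinite (UNIV :: 'a set)"
    and "commutative_variety V"
    and "nil_variety V"
  shows "(upper_modular_element Com V \<longleftrightarrow> codistributive_element Com V) \<and>
         (codistributive_element Com V \<longleftrightarrow> costandard_element Com V) \<and>
         (costandard_element Com V \<longleftrightarrow>
            variety_satisfies V (zero_identities [0, 0, 1, 2]) \<and>
            variety_satisfies V {([0, 0, 1], [0, 1, 1])})"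
proof -
  interpret Com: lattice "Com :: 'a sgrp set gorder" by (rule lattice_Com)
  have balanced: "variety_satisfies V {([0, 0, 1], [0, 1, 1])} \<longleftrightarrow> theory_of V {#0, 0, 1#} {#0, 1, 1#}"
    using theory_of_mset[OF assms(2), of "[0, 0, 1]" "[0, 1, 1]"] by simp
  have "costandard_element Com V \<Longrightarrow> codistributive_element Com V"
    by (rule Com.costandard_imp_codistributive)
  moreover have "codistributive_element Com V \<Longrightarrow> upper_modular_element Com V"
    by (rule Com.codistributive_imp_upper_modular)
  moreover have "upper_modular_element Com V \<Longrightarrow> theory_of V {#0, 0, 1#} {#0, 1, 1#}"
    by (rule upper_modular_imp_balanced[OF assms])
  moreover have "theory_of V {#0, 0, 1#} {#0, 1, 1#} \<Longrightarrow>
      variety_satisfies V (zero_identities [0, 0, 1, 2])"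
    by (rule balanced_imp_zero_identities[OF assms(2,3)])
  moreover have "variety_satisfies V (zero_identities [0, 0, 1, 2]) \<Longrightarrow>
      theory_of V {#0, 0, 1#} {#0, 1, 1#} \<Longrightarrow> costandard_element Com V"
    by (rule identities_imp_costandard[OF assms(1,2)])
  ultimately show ?thesis unfolding balanced by blast
qed

end
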